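(* Let $n\ge 2$ be an integer and let $p_0,\ldots,p_{n-1}\in\mathbb{R}^{1,n}$ be $n$ points in general position. Then the following hold: (1) There exists a $C^\infty$ diffeomorphism $h:\mathbb{R}^{1,n}\to\mathbb{R}^{1,n}$ by which any non-singular fiber $L_{(p_0,\ldots,p_{n-1})}^{-1}(y)$ is mapped to a circle if and only if the recognition subspace $V(p_0,\ldots,p_{n-1})$ is time-like. (2) There exists a $C^\infty$ diffeomorphism $h:\mathbb{R}^{1,n}\to\mathbb{R}^{1,n}$ by which any non-singular fiber $L_{(p_0,\ldots,p_{n-1})}^{-1}(y)$ is mapped to an equilateral hyperbola if and only if $V(p_0,\ldots,p_{n-1})$ is space-like. (3) There exists a $C^\infty$ diffeomorphism $h:\mathbb{R}^{1,n}\to\mathbb{R}^{1,n}$ by which any non-singular fiber $L_{(p_0,\ldots,p_{n-1})}^{-1}(y)$ is mapped to a parabola (possibly at infinity) if and only if $V(p_0,\ldots,p_{n-1})$ is light-like.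
   Context: For a positive integer $n$, $\mathbb{R}^{1,n}$ denotes the vector space $\mathbb{R}^{n+1}$ (coordinates $x=(x_0,x_1,\ldots,x_n)$) equipped with the Lorentzian inner product $\langle x,y\rangle=-x_0y_0+x_1y_1+\cdots+x_ny_n$. A nonzero vector $x\in\mathbb{R}^{1,n}$ is space-like, light-like or time-like if $\langle x,x\rangle>0$, $=0$, $<0$ respectively. A vector subspace $V\subset\mathbb{R}^{1,n}$ is time-like if it contains a time-like vector; space-like if every nonzero vector of $V$ is space-like; light-like otherwise. For $p\in\mathbb{R}^{1,n}$, $\ell_p^2(x)=\langle x-p,x-p\rangle$. For points $p_0,\ldots,p_k\in\mathbb{R}^{1,n}$ ($k\ge1$), the Lorentzian distance-squared mapping is $L_{(p_0,\ldots,p_k)}:\mathbb{R}^{1,n}\to\mathbb{R}^{k+1}$, $L_{(p_0,\ldots,p_k)}(x)=(\ell_{p_0}^2(x),\ldots,\ell_{p_k}^2(x))$. The recognition subspace is $V(p_0,\ldots,p_k)=\sum_{i=1}^k\mathbb{R}\,(p_i-p_0)\subset\mathbb{R}^{1,n}$. The points $p_0,\ldots,p_k$ are in general position if $\dim V(p_0,\ldots,p_k)=k$. A non-singular fiber of a smooth map $f:\mathbb{R}^{1,n}\to\mathbb{R}^n$ is a nonempty set $f^{-1}(y)$, $y\in\mathbb{R}^n$, containing no singular point of $f$ (i.e. the differential of $f$ has rank $n$ at each of its points). In each item a single $h$ must work for all non-singular fibers simultaneously. Circle, equilateral (rectangular) hyperbola (both branches) and parabola mean the usual Euclidean plane curves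 lying in some affine $2$-plane of $\mathbb{R}^{n+1}$. "Parabola (possibly at infinity)" means a parabola or a pair of distinct parallel lines in an affine $2$-plane (e.g. the non-singular fibers of $(x_0,\ldots,x_n)\mapsto(x_1,\ldots,x_{n-1},x_0x_1+x_n^2)$ are of this kind). *)

theory Defs
  imports "HOL-Analysis.Analysis"
begin

text \<open>
  The space $\mathbb{R}^{1,n}$ is the Euclidean space \<^typ>\<open>real \<times> (real ^ 'n)\<close> with
  \<open>n = CARD('n)\<close>: the first component is the coordinate $x_0$, the second one is
  $(x_1, \ldots, x_n)$.
\<close>

type_synonym 'n minkowski = "real \<times> (real ^ 'n)"

definition lorentz_inner :: "'n::finite minkowski \<Rightarrow> 'n minkowski \<Rightarrow> real" where
  "lorentz_inner x y = - (fst x * fst y) + (\<Sum>i\<in>UNIV. snd x $ i * snd y $ i)"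

definition spacelike :: "'n::finite minkowski \<Rightarrow> bool" where
  "spacelike x \<longleftrightarrow> x \<noteq> 0 \<and> lorentz_inner x x > 0"

definition timelike :: "'n::finite minkowski \<Rightarrow> bool" where
  "timelike x \<longleftrightarrow> x \<noteq> 0 \<and> lorentz_inner x x < 0"

definition timelike_subspace :: "'n::finite minkowski set \<Rightarrow> bool" where
  "timelike_subspace V \<longleftrightarrow> subspace V \<and> (\<exists>x\<in>V. timelike x)"

definition spacelike_subspace :: "'n::finite minkowski set \<Rightarrow> bool" where
  "spacelike_subspace V \<longleftrightarrow> subspace V \<and> (\<forall>x\<in>V. x \<noteq> 0 \<longrightarrow> spacelike x)"

definition lightlike_subspace :: "'n::finite minkowski set \<Rightarrow> bool" where
  "lightlike_subspace V \<longleftrightarrow>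
     subspace V \<and> \<not> timelike_subspace V \<and> \<not> spacelike_subspace V"

text \<open>
  A tuple $(p_0, \ldots, p_k)$ is a family \<open>p\<close> over a finite index type \<open>'k\<close> with
  \<open>CARD('k) = k + 1\<close>; the index of the base point $p_0$ is passed separately, as \<open>i0\<close>.
\<close>

definition lorentz_dist_sq :: "'n::finite minkowski \<Rightarrow> 'n minkowski \<Rightarrow> real" where
  "lorentz_dist_sq q x = lorentz_inner (x - q) (x - q)"

definition lorentz_dist_sq_map ::
    "('k::finite \<Rightarrow> 'n::finite minkowski) \<Rightarrow> 'n minkowski \<Rightarrow> real ^ 'k" where
  "lorentz_dist_sq_map p x = (\<chi> i. lorentz_dist_sq (p i) x)"

definition recognition_subspace ::
    "'k \<Rightarrow> ('k::finite \<Rightarrow> 'n::finite minkowski) \<Rightarrow> 'n minkowski set" where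
  "recognition_subspace i0 p = span {p i - p i0 | i. i \<noteq> i0}"

definition general_position :: "'k \<Rightarrow> ('k::finite \<Rightarrow> 'n::finite minkowski) \<Rightarrow> bool" where
  "general_position i0 p \<longleftrightarrow> dim (recognition_subspace i0 p) = CARD('k) - 1"

text \<open>
  The map \<open>f\<close> is of class $C^{k+1}$ iff it is differentiable and all its directional
  derivatives are of class $C^k$.
\<close>

primrec Ck_map :: "nat \<Rightarrow> ('a::euclidean_space \<Rightarrow> 'b::euclidean_space) \<Rightarrow> bool" where
  "Ck_map 0 f \<longleftrightarrow> continuous_on UNIV f"
| "Ck_map (Suc k) f \<longleftrightarrow>
     (\<forall>x. f differentiable (at x)) \<and>
     (\<forall>v. Ck_map k (\<lambda>x. frechet_derivative f (at x) v))"

definition smooth_map :: "('a::euclidean_space \<Rightarrow> 'b::euclidean_space) \<Rightarrow> bool" where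
  "smooth_map f \<longleftrightarrow> (\<forall>k. Ck_map k f)"

definition diffeomorphism :: "('a::euclidean_space \<Rightarrow> 'b::euclidean_space) \<Rightarrow> bool" where
  "diffeomorphism h \<longleftrightarrow> bij h \<and> smooth_map h \<and> smooth_map (inv h)"

definition singular_point :: "('a::euclidean_space \<Rightarrow> 'b::euclidean_space) \<Rightarrow> 'a \<Rightarrow> bool" where
  "singular_point f x \<longleftrightarrow> dim (range (frechet_derivative f (at x))) \<noteq> DIM('b)"

definition nonsingular_fiber ::
    "('a::euclidean_space \<Rightarrow> 'b::euclidean_space) \<Rightarrow> 'a set \<Rightarrow> bool" where
  "nonsingular_fiber f F \<longleftrightarrow>
     (\<exists>y. F = f -` {y}) \<and> F \<noteq> {} \<and> (\<forall>x\<in>F. \<not> singular_point f x)"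

text \<open>
  Plane curves are given by an equation \<open>E s t\<close> in Cartesian coordinates of an affine
  2-plane. The frame is orthonormal for the Euclidean inner product of the ambient space,
  not for the Lorentzian one.
\<close>

definition planar_locus :: "(real \<Rightarrow> real \<Rightarrow> bool) \<Rightarrow> 'a::euclidean_space set \<Rightarrow> bool" where
  "planar_locus E C \<longleftrightarrow>
     (\<exists>c u v. norm u = 1 \<and> norm v = 1 \<and> u \<bullet> v = 0 \<and>
        C = {c + s *\<^sub>R u + t *\<^sub>R v | s t. E s t})"

definition is_circle :: "'a::euclidean_space set \<Rightarrow> bool" where
  "is_circle C \<longleftrightarrow> (\<exists>r>0. planar_locus (\<lambda>s t. s\<^sup>2 + t\<^sup>2 = r\<^sup>2) C)"

definition is_equilateral_hyperbola :: "'a::euclidean_space set \<Rightarrow> bool" where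
  "is_equilateral_hyperbola C \<longleftrightarrow> (\<exists>a>0. planar_locus (\<lambda>s t. s\<^sup>2 - t\<^sup>2 = a\<^sup>2) C)"

definition is_parabola :: "'a::euclidean_space set \<Rightarrow> bool" where
  "is_parabola C \<longleftrightarrow> (\<exists>a>0. planar_locus (\<lambda>s t. t = a * s\<^sup>2) C)"

definition is_parallel_line_pair :: "'a::euclidean_space set \<Rightarrow> bool" where
  "is_parallel_line_pair C \<longleftrightarrow> (\<exists>a b. a \<noteq> b \<and> planar_locus (\<lambda>s t. t = a \<or> t = b) C)"

definition is_parabola_or_at_infinity :: "'a::euclidean_space set \<Rightarrow> bool" where
  "is_parabola_or_at_infinity C \<longleftrightarrow> is_parabola C \<or> is_parallel_line_pair C"

end

theory Submission
  imports Defs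
begin

text \<open>
  Write \<open>V\<close> for the recognition subspace and \<open>W\<close> for its Lorentzian orthogonal complement, which is
  a plane because \<open>V\<close> has codimension 2.  The components of the distance-squared mapping have the same
  quadratic part, so their differences are affine functions whose common level sets are the translates of
  \<open>W\<close>.  A fiber is therefore the zero set of a quadratic polynomial in such a translate, with
  quadratic part the restriction of the Lorentzian form to \<open>W\<close>.  In a basis \<open>f\<close>, \<open>g\<close> of
  \<open>W\<close> that diagonalizes this restriction as \<open>s\<^sup>2 + \<epsilon> t\<^sup>2\<close> the fibers can be written
  down explicitly (\<open>fiber_eq\<close>), and a point is singular iff its displacement from the points \<open>p i\<close> is
  orthogonal to \<open>W\<close> (\<open>singular_point_iff\<close>).  The subspace \<open>V\<close> is time-like, space-like or
  light-like according to whether \<open>\<epsilon>\<close> is 1, -1 or 0.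

  \<^emph>\<open>Existence of \<open>h\<close>.\<close>  All fibers lie in parallel planes, so one linear isomorphism that
  makes \<open>f\<close>, \<open>g\<close> orthonormal turns all nonsingular fibers simultaneously into circles,
  equilateral hyperbolas, or parabolas and pairs of parallel lines.

  \<^emph>\<open>Necessity.\<close>  A diffeomorphism preserves compactness and connectedness of a fiber.  Compactness
  characterizes \<open>\<epsilon> = 1\<close>.  Some fiber is connected if \<open>\<epsilon> = 0\<close>, so these fibers cannot
  all become hyperbolas.  Topology does not suffice for \<open>\<epsilon> = - 1\<close>, since a hyperbola is homeomorphic
  to a pair of parallel lines.  Here the family of fibers matters: the hyperbolas around the
  point \<open>p i0\<close> shrink towards it by scaling, so by rescaling \<open>h\<close> at this point its derivative would
  have to map a hyperbola branch into a line (\<open>not_collinear_hyperbola_branches\<close>), although it is injective.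
\<close>

section \<open>The Lorentzian inner product and orthogonal complements\<close>

lemma lorentz_inner_eq: "lorentz_inner x y = x \<bullet> (- fst y, snd y)"
  by (simp add: lorentz_inner_def inner_prod_def inner_vec_def)

lemma bilinear_lorentz_inner: "bilinear lorentz_inner"
  unfolding bilinear_def lorentz_inner_eq
  by (auto intro!: linearI simp: inner_prod_def algebra_simps)

lemmas lorentz_inner_simps [simp] =
  bilinear_ladd [OF bilinear_lorentz_inner] bilinear_radd [OF bilinear_lorentz_inner]
  bilinear_lsub [OF bilinear_lorentz_inner] bilinear_rsub [OF bilinear_lorentz_inner]
  bilinear_lmul [OF bilinear_lorentz_inner] bilinear_rmul [OF bilinear_lorentz_inner]
  bilinear_lneg [OF bilinear_lorentz_inner] bilinear_rneg [OF bilinear_lorentz_inner]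
  bilinear_lzero [OF bilinear_lorentz_inner] bilinear_rzero [OF bilinear_lorentz_inner]

lemma lorentz_inner_commute: "lorentz_inner x y = lorentz_inner y x"
  by (simp add: lorentz_inner_def mult.commute)

text \<open>
  The reverse Cauchy-Schwarz phenomenon: the form has only one negative direction, so the
  orthogonal complement of a time-like vector is positive definite.
\<close>

lemma orthogonal_to_timelike:
  assumes t: "lorentz_inner t t < 0" and orth: "lorentz_inner t x = 0" and "x \<noteq> 0"
  shows "lorentz_inner x x > 0"
proof -
  have t2: "snd t \<bullet> snd t < (fst t)\<^sup>2"
    using t by (simp add: lorentz_inner_eq inner_prod_def power2_eq_square)
  have eq: "fst t * fst x = snd t \<bullet> snd x"
    using orth by (simp add: lorentz_inner_eq inner_prod_def)
  show ?thesis
  proof (cases "fst x = 0")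
    case True
    then have "snd x \<noteq> 0" using \<open>x \<noteq> 0\<close> by (simp add: prod_eq_iff)
    then show ?thesis using True by (simp add: lorentz_inner_eq inner_prod_def)
  next
    case False
    then have x0: "(fst x)\<^sup>2 > 0" by simp
    have "(fst t)\<^sup>2 * (fst x)\<^sup>2 = (snd t \<bullet> snd x)\<^sup>2"
      by (metis eq power_mult_distrib)
    also have "\<dots> \<le> (snd t \<bullet> snd t) * (snd x \<bullet> snd x)"
      by (rule Cauchy_Schwarz_ineq)
    finally have le: "(fst t)\<^sup>2 * (fst x)\<^sup>2 \<le> (snd t \<bullet> snd t) * (snd x \<bullet> snd x)" .
    have tp: "(fst t)\<^sup>2 > 0" using t2 by (meson inner_ge_zero le_less_trans)
    have "snd x \<bullet> snd x > 0"
      using le tp x0 by (smt (verit) inner_ge_zero mult_eq_0_iff mult_pos_pos)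
    then have "(snd t \<bullet> snd t) * (snd x \<bullet> snd x) < (fst t)\<^sup>2 * (snd x \<bullet> snd x)"
      using t2 by simp
    with le have "(fst t)\<^sup>2 * (fst x)\<^sup>2 < (fst t)\<^sup>2 * (snd x \<bullet> snd x)" by simp
    then have "(fst x)\<^sup>2 < snd x \<bullet> snd x" using tp by simp
    then show ?thesis by (simp add: lorentz_inner_eq inner_prod_def power2_eq_square)
  qed
qed

definition lorentz_complement :: "'n::finite minkowski set \<Rightarrow> 'n minkowski set" where
  "lorentz_complement V = {x. \<forall>v\<in>V. lorentz_inner v x = 0}"

lemma subspace_lorentz_complement: "subspace (lorentz_complement V)"
  by (auto simp: subspace_def lorentz_complement_def)

text \<open>
  The Lorentzian complement is the Euclidean one reflected in the first coordinate, so it has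
  the same dimension.  It may however contain nonzero vectors of \<open>V\<close>,
  namely when the form degenerates on \<open>V\<close>.
\<close>

lemma dim_lorentz_complement:
  fixes V :: "'n::finite minkowski set"
  assumes "subspace V"
  shows "dim (lorentz_complement V) + dim V = CARD('n) + 1"
proof -
  define J :: "'n minkowski \<Rightarrow> 'n minkowski" where "J x = (- fst x, snd x)" for x
  have J: "linear J" by (auto intro!: linearI simp: J_def)
  have JJ: "J (J x) = x" for x by (simp add: J_def)
  define E where "E = {y. \<forall>v\<in>V. orthogonal v y}"
  have "lorentz_complement V = J ` E"
  proof (intro set_eqI iffI)
    fix x assume "x \<in> lorentz_complement V"
    then have "J x \<in> E"
      by (auto simp: lorentz_complement_def lorentz_inner_eq E_def orthogonal_def J_def)
    then show "x \<in> J ` E" by (metis JJ imageI)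
  qed (auto simp: lorentz_complement_def lorentz_inner_eq E_def orthogonal_def J_def)
  then have "dim (lorentz_complement V) = dim E"
    using dim_image_eq[OF J, of E] by (metis JJ inj_onI)
  moreover have "dim E + dim V = CARD('n) + 1"
    using dim_subspace_orthogonal_to_vectors[OF assms subspace_UNIV] by (simp add: E_def)
  ultimately show ?thesis by simp
qed

text \<open>
  Every plane meets the positive definite hyperplane \<open>x\<^sub>0 = 0\<close> in a nonzero vector, which is why
  a diagonal basis can always start with a space-like vector.
\<close>

lemma diagonal_basis_plane:
  fixes W :: "'n::finite minkowski set"
  assumes W: "subspace W" and dim: "dim W = 2"
  obtains f g where "\<And>x. x \<in> W \<longleftrightarrow> (\<exists>a b. x = a *\<^sub>R f + b *\<^sub>R g)"
    "\<And>a b. a *\<^sub>R f + b *\<^sub>R g = 0 \<Longrightarrow> a = 0 \<and> b = 0"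
    "lorentz_inner f f = 1" "lorentz_inner g g \<in> {1, -1, 0}" "lorentz_inner f g = 0"
proof -
  obtain B where B: "B \<subseteq> W" "pairwise orthogonal B" "\<And>x. x \<in> B \<Longrightarrow> norm x = 1" "card B = 2"
    using orthonormal_basis_subspace[OF W] dim by metis
  obtain u v where uv: "B = {u, v}" "u \<noteq> v" using B(4) by (meson card_2_iff)
  have uvW: "u \<in> W" "v \<in> W" using uv B by auto
  have on: "u \<bullet> v = 0" "u \<bullet> u = 1" "v \<bullet> v = 1"
    using B(2,3) uv by (auto simp: pairwise_insert orthogonal_def dot_square_norm)
  \<comment> \<open>a nonzero vector of the plane whose first coordinate vanishes\<close>
  define w where "w = (if fst u = 0 then u else fst v *\<^sub>R u - fst u *\<^sub>R v)"
  have w: "w \<in> W" "fst w = 0"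
    using uvW W by (auto simp: w_def subspace_diff subspace_scale)
  have "w \<bullet> (if fst u = 0 then u else v) \<noteq> 0"
    using on by (auto simp: w_def inner_diff_left)
  then have "w \<noteq> 0" by auto
  then have "snd w \<noteq> 0" using w(2) by (simp add: prod_eq_iff)
  then have Qw: "lorentz_inner w w > 0"
    using w(2) by (simp add: lorentz_inner_eq inner_prod_def)
  define f where "f = (1 / sqrt (lorentz_inner w w)) *\<^sub>R w"
  have f: "f \<in> W" "lorentz_inner f f = 1"
    using w W Qw by (auto simp: f_def subspace_scale field_simps)
  have "\<not> W \<subseteq> span {f}"
    using dim dim_le_card[of W "{f}"] by auto
  then obtain k where k: "k \<in> W" "k \<notin> span {f}" by blast
  define e where "e = k + (- lorentz_inner f k) *\<^sub>R f"
  have e: "e \<in> W" "e \<notin> span {f}" "lorentz_inner f e = 0"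
    using k f W
    by (auto simp: e_def subspace_diff subspace_scale span_base span_scale
        simp flip: span_add_eq2[of "lorentz_inner f k *\<^sub>R f" "{f}" "k - lorentz_inner f k *\<^sub>R f"])
  \<comment> \<open>a null vector cannot be normalized and is left as it is\<close>
  define c where "c = (if lorentz_inner e e = 0 then 1 else 1 / sqrt \<bar>lorentz_inner e e\<bar>)"
  have c: "c \<noteq> 0" "c * (c * lorentz_inner e e) \<in> {1,-1,0}"
    by (auto simp: c_def field_simps abs_if)
  define g where "g = c *\<^sub>R e"
  have g: "g \<in> W" "lorentz_inner f g = 0" "lorentz_inner g g \<in> {1,-1,0}"
    using e c W by (auto simp: g_def subspace_scale)
  have g': "g \<notin> span {f}"
  proof
    assume "g \<in> span {f}"
    then have "(1/c) *\<^sub>R g \<in> span {f}" by (rule span_scale)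
    then show False using e(2) c(1) by (simp add: g_def)
  qed
  have indep: "a = 0 \<and> b = 0" if "a *\<^sub>R f + b *\<^sub>R g = 0" for a b
  proof -
    have "b = 0"
    proof (rule ccontr)
      assume "b \<noteq> 0"
      have "b *\<^sub>R g = - a *\<^sub>R f"
        using that by (simp add: add_eq_0_iff)
      then have "(1/b) *\<^sub>R (b *\<^sub>R g) = (1/b) *\<^sub>R (- a *\<^sub>R f)" by simp
      then have "g = (- a / b) *\<^sub>R f" using \<open>b \<noteq> 0\<close> by simp
      then show False using g' by (metis insertI1 span_base span_scale)
    qed
    moreover have "f \<noteq> 0" using f(2) by auto
    ultimately show ?thesis using that by auto
  qed
  have "f \<noteq> g" using g' by (metis insertI1 span_base)
  have "independent {g, f}"
    using g' f(2) by (auto simp: independent_insert)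
  then have "span {g, f} = W"
    using dim_eq_span[of "{g,f}" W] f(1) g(1) dim W \<open>f \<noteq> g\<close>
    by (auto simp: dim_eq_card_independent span_eq_iff[THEN iffD2])
  then have "x \<in> W \<longleftrightarrow> (\<exists>a b. x = a *\<^sub>R f + b *\<^sub>R g)" for x
    by (fastforce simp: set_eq_iff span_insert span_singleton image_iff algebra_simps)
  then show ?thesis using that indep f(2) g(2,3) by blast
qed

section \<open>Fibers and singular points of the distance-squared mapping\<close>

lemma independent_pairI:
  fixes f g :: "'a::real_vector"
  assumes indep: "\<And>a b. a *\<^sub>R f + b *\<^sub>R g = 0 \<Longrightarrow> a = 0 \<and> b = 0"
  shows "independent {f, g}" "f \<noteq> g"
proof -
  have "f \<noteq> k *\<^sub>R g" for k using indep[of 1 "- k"] by auto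
  moreover have "g \<noteq> 0" using indep[of 0 1] by auto
  ultimately show "independent {f, g}" "f \<noteq> g"
    by (auto simp: independent_insert span_singleton) (metis scaleR_one)
qed

text \<open>
  Rank-nullity: a linear map is injective on the orthogonal complement of its kernel.
\<close>

lemma dim_range_plus_dim_kernel:
  fixes D :: "'a::euclidean_space \<Rightarrow> 'b::euclidean_space"
  assumes "linear D"
  shows "dim (range D) + dim {x. D x = 0} = DIM('a)"
proof -
  interpret linear D by fact
  define K where "K = {x. D x = 0}"
  have K: "subspace K" unfolding K_def by (auto simp: subspace_def add scale)
  define E where "E = {y. \<forall>x\<in>K. orthogonal x y}"
  have E: "subspace E" unfolding E_def by (rule subspace_orthogonal_to_vectors)
  have "D x \<in> D ` E" for x
  proof -
    obtain y z where yz: "y \<in> span K" "\<And>w. w \<in> span K \<Longrightarrow> orthogonal z w" "x = y + z"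
      using orthogonal_subspace_decomp_exists by blast
    then have "D x = D z" "z \<in> E"
      using K by (auto simp: add K_def E_def orthogonal_commute span_eq_iff[THEN iffD2])
    then show ?thesis by blast
  qed
  then have "range D = D ` E" by blast
  moreover have "inj_on D E"
  proof (rule inj_onI)
    fix x y assume xy: "x \<in> E" "y \<in> E" "D x = D y"
    then have "x - y \<in> K" "x - y \<in> E" using E by (auto simp: K_def diff subspace_diff)
    then have "orthogonal (x - y) (x - y)" unfolding E_def by blast
    then show "x = y" by (simp add: orthogonal_def)
  qed
  ultimately have "dim (range D) = dim E"
    using dim_image_eq[OF assms, of E] E by (simp add: span_eq_iff[THEN iffD2])
  moreover have "dim E + dim K = DIM('a)"
    using dim_subspace_orthogonal_to_vectors[OF K subspace_UNIV] by (simp add: E_def)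
  ultimately show ?thesis by (simp add: K_def)
qed

text \<open>
  The quadratic part is the same for every centre \<open>q\<close>.  Hence differences of the components of
  the distance-squared mapping are affine, and its fibers are quadrics inside translates of the
  Lorentzian complement of the recognition subspace.
\<close>

lemma lorentz_dist_sq_add:
  "lorentz_dist_sq q (x + w) = lorentz_dist_sq q x + 2 * lorentz_inner (x - q) w + lorentz_inner w w"
  by (simp add: lorentz_dist_sq_def lorentz_inner_commute algebra_simps)

lemma mem_lorentz_complement_recognition_subspace_iff:
  "w \<in> lorentz_complement (recognition_subspace i0 p)
    \<longleftrightarrow> (\<forall>i. lorentz_inner (p i) w = lorentz_inner (p i0) w)"
proof
  assume *: "\<forall>i. lorentz_inner (p i) w = lorentz_inner (p i0) w"
  have "lorentz_inner v w = 0" if "v \<in> recognition_subspace i0 p" for v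
    using that unfolding recognition_subspace_def
    by (induction rule: span_induct) (use * in \<open>auto simp: subspace_def\<close>)
  then show "w \<in> lorentz_complement (recognition_subspace i0 p)"
    by (simp add: lorentz_complement_def)
next
  assume w: "w \<in> lorentz_complement (recognition_subspace i0 p)"
  show "\<forall>i. lorentz_inner (p i) w = lorentz_inner (p i0) w"
  proof
    fix i
    have "p i - p i0 \<in> recognition_subspace i0 p"
      unfolding recognition_subspace_def by (cases "i = i0") (auto intro: span_base span_zero)
    then have "lorentz_inner (p i - p i0) w = 0" using w unfolding lorentz_complement_def by blast
    then show "lorentz_inner (p i) w = lorentz_inner (p i0) w" by simp
  qed
qed

lemma has_derivative_lorentz_dist_sq_map:
  fixes p :: "'k::finite \<Rightarrow> 'n::finite minkowski"
  shows "(lorentz_dist_sq_map p has_derivative (\<lambda>v. \<chi> i. 2 * lorentz_inner (x - p i) v)) (at x)"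
proof -
  have "((\<lambda>x. lorentz_dist_sq q x) has_derivative (\<lambda>v. 2 * lorentz_inner (x - q) v)) (at x)" for q
    unfolding lorentz_dist_sq_def lorentz_inner_eq inner_prod_def
    by (auto intro!: derivative_eq_intros simp: algebra_simps inner_commute)
  then have "((\<lambda>x. \<Sum>i\<in>UNIV. lorentz_dist_sq (p i) x *\<^sub>R axis i 1) has_derivative
      (\<lambda>v. \<Sum>i\<in>UNIV. (2 * lorentz_inner (x - p i) v) *\<^sub>R (axis i 1 :: real ^ 'k))) (at x)"
    by (intro has_derivative_sum has_derivative_scaleR_left)
  moreover have "(\<Sum>i\<in>UNIV. c i *\<^sub>R (axis i 1 :: real ^ 'k)) = (\<chi> i. c i)" for c
    using basis_expansion[of "\<chi> i. c i"] by (simp add: scalar_mult_eq_scaleR)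
  ultimately show ?thesis unfolding lorentz_dist_sq_map_def by simp
qed

text \<open>
  A basis \<open>f\<close>, \<open>g\<close> of the Lorentzian complement of the recognition subspace that diagonalizes the
  form.  The sign of \<open>\<epsilon>\<close>, which can be normalized to 1, -1 or 0, decides the shape of all fibers.
\<close>

locale complement_frame =
  fixes p :: "'n::finite \<Rightarrow> 'n minkowski" and i0 :: 'n and f g :: "'n minkowski" and \<epsilon> :: real
  assumes complement: "\<And>x. x \<in> lorentz_complement (recognition_subspace i0 p)
      \<longleftrightarrow> (\<exists>a b. x = a *\<^sub>R f + b *\<^sub>R g)"
    and indep: "\<And>a b. a *\<^sub>R f + b *\<^sub>R g = 0 \<Longrightarrow> a = 0 \<and> b = 0"
    and ff: "lorentz_inner f f = 1" and gg: "lorentz_inner g g = \<epsilon>"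
    and fg: "lorentz_inner f g = 0"

context complement_frame
begin

abbreviation "L \<equiv> lorentz_dist_sq_map p"

lemma lorentz_inner_fg [simp]:
  "lorentz_inner f f = 1" "lorentz_inner g g = \<epsilon>" "lorentz_inner f g = 0" "lorentz_inner g f = 0"
  using ff gg fg lorentz_inner_commute[of g f] by simp_all

lemma lorentz_inner_frame [simp]:
  "lorentz_inner (a *\<^sub>R f + b *\<^sub>R g) (a *\<^sub>R f + b *\<^sub>R g) = a\<^sup>2 + \<epsilon> * b\<^sup>2"
  by (simp add: power2_eq_square)

text \<open>
  A displacement changes all components by the same amount iff it lies in the plane spanned by
  \<open>f\<close> and \<open>g\<close>.  It stays in the fiber iff moreover this amount is zero, which is the equation.
\<close>

lemma fiber_eq:
  "L -` {L x} = {x + a *\<^sub>R f + b *\<^sub>R g | a b.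
     a\<^sup>2 + \<epsilon> * b\<^sup>2 + 2 * (a * lorentz_inner (x - p i0) f + b * lorentz_inner (x - p i0) g) = 0}"
proof -
  have "L (x + w) = L x \<longleftrightarrow> w \<in> lorentz_complement (recognition_subspace i0 p)
      \<and> lorentz_inner w w + 2 * lorentz_inner (x - p i0) w = 0" for w
    unfolding mem_lorentz_complement_recognition_subspace_iff lorentz_dist_sq_map_def vec_eq_iff
    by (auto simp: lorentz_dist_sq_add) smt+
  then have "L z = L x \<longleftrightarrow> (\<exists>a b. z - x = a *\<^sub>R f + b *\<^sub>R g \<and>
      lorentz_inner (z - x) (z - x) + 2 * lorentz_inner (x - p i0) (z - x) = 0)" for z
    by (metis add_diff_cancel_left' add_diff_eq complement)
  moreover have "z - x = w \<longleftrightarrow> z = x + w" for z w by (auto simp: algebra_simps)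
  ultimately have "L z = L x \<longleftrightarrow> (\<exists>a b. z = x + (a *\<^sub>R f + b *\<^sub>R g) \<and>
      lorentz_inner (a *\<^sub>R f + b *\<^sub>R g) (a *\<^sub>R f + b *\<^sub>R g)
       + 2 * lorentz_inner (x - p i0) (a *\<^sub>R f + b *\<^sub>R g) = 0)" for z
    by (metis (no_types, lifting))
  then show ?thesis
    unfolding lorentz_inner_frame by (auto simp: set_eq_iff add.assoc)
qed

text \<open>
  The kernel of the differential at \<open>x\<close> is the part of the plane spanned by \<open>f\<close> and \<open>g\<close> that is
  orthogonal to \<open>x - p i0\<close>.  The rank is maximal iff this kernel is a line, that is, iff
  \<open>x - p i0\<close> is not orthogonal to the whole plane.
\<close>

lemma singular_point_iff:
  "singular_point L x \<longleftrightarrow> lorentz_inner (x - p i0) f = 0 \<and> lorentz_inner (x - p i0) g = 0"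
proof -
  let ?D = "\<lambda>v. (\<chi> i. 2 * lorentz_inner (x - p i) v) :: real ^ 'n"
  let ?K = "{v. ?D v = 0}"
  define b1 b2 where b: "b1 = lorentz_inner (x - p i0) f" "b2 = lorentz_inner (x - p i0) g"
  have D: "linear ?D" using has_derivative_linear[OF has_derivative_lorentz_dist_sq_map] .
  have "v \<in> ?K \<longleftrightarrow> (\<exists>s t. v = s *\<^sub>R f + t *\<^sub>R g) \<and> lorentz_inner (x - p i0) v = 0" for v
    unfolding complement[symmetric] mem_lorentz_complement_recognition_subspace_iff vec_eq_iff by auto metis+
  moreover have "lorentz_inner (x - p i0) (s *\<^sub>R f + t *\<^sub>R g) = s * b1 + t * b2" for s t
    unfolding b by (simp add: algebra_simps)
  ultimately have K: "v \<in> ?K \<longleftrightarrow> (\<exists>s t. v = s *\<^sub>R f + t *\<^sub>R g \<and> s * b1 + t * b2 = 0)" for v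
    by (metis (no_types, lifting))
  have sing: "singular_point L x \<longleftrightarrow> dim ?K \<noteq> 1"
    using dim_range_plus_dim_kernel[OF D]
    unfolding singular_point_def frechet_derivative_at[OF has_derivative_lorentz_dist_sq_map, symmetric]
    by auto
  show ?thesis
  proof (cases "b1 = 0 \<and> b2 = 0")
    case True
    have "independent {f, g}" "f \<noteq> g" using independent_pairI[of f g] indep by blast+
    moreover have "f \<in> ?K"
      unfolding K by (rule exI[of _ 1], rule exI[of _ 0]) (simp add: True)
    moreover have "g \<in> ?K"
      unfolding K by (rule exI[of _ 0], rule exI[of _ 1]) (simp add: True)
    ultimately have "2 \<le> dim ?K"
      using independent_card_le_dim[of "{f, g}" ?K] by simp
    then have "dim ?K \<noteq> 1" by simp
    with True sing show ?thesis by (simp add: b)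
  next
    case False
    define d where "d = b2 *\<^sub>R f + (- b1) *\<^sub>R g"
    have "d \<noteq> 0" using False indep[of b2 "- b1"] by (auto simp: d_def)
    have "?K = span {d}"
    proof (intro set_eqI iffI)
      fix v assume "v \<in> ?K"
      then obtain s t where st: "v = s *\<^sub>R f + t *\<^sub>R g" "s * b1 + t * b2 = 0" unfolding K by blast
      obtain k where "s = k * b2" "t = k * - b1"
      proof (cases "b2 = 0")
        case True
        then show ?thesis using st(2) False that[of "- t / b1"] by auto
      next
        case False
        then show ?thesis using st(2) that[of "s / b2"] by (simp add: field_simps)
      qed
      then have "v = k *\<^sub>R d"
        unfolding st(1) d_def by (simp add: scaleR_add_right scaleR_diff_right)
      then show "v \<in> span {d}" by (simp add: span_base span_scale)
    next
      fix v assume "v \<in> span {d}"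
      then obtain k where "v = k *\<^sub>R d" by (auto simp: span_singleton)
      then show "v \<in> ?K" unfolding K
        by (intro exI[of _ "k * b2"] exI[of _ "- k * b1"]) (simp add: d_def algebra_simps)
    qed
    then have "dim ?K = 1" using \<open>d \<noteq> 0\<close> by simp
    with False sing show ?thesis by (simp add: b)
  qed
qed

end

section \<open>The causal character of the recognition subspace\<close>

lemma complement_frame_exists:
  fixes p :: "'n::finite \<Rightarrow> 'n minkowski"
  assumes "general_position i0 p"
  obtains f g \<epsilon> where "complement_frame p i0 f g \<epsilon>" "\<epsilon> \<in> {1, - 1, 0}"
proof -
  have "subspace (recognition_subspace i0 p)"
    unfolding recognition_subspace_def by (rule subspace_span)
  from dim_lorentz_complement[OF this] assms
  have "dim (lorentz_complement (recognition_subspace i0 p)) = 2"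
    unfolding general_position_def using zero_less_card_finite[where 'a = 'n] by simp
  with subspace_lorentz_complement show ?thesis
    by (rule diagonal_basis_plane) (rule that, unfold_locales, assumption+, simp_all)
qed

context complement_frame
begin

text \<open>
  The vector \<open>g\<close> is orthogonal to a time-like vector, hence space-like.
\<close>

lemma sign_if_timelike:
  assumes "timelike_subspace (recognition_subspace i0 p)" and "\<epsilon> \<in> {1, - 1, 0}"
  shows "\<epsilon> = 1"
proof -
  obtain t where "t \<in> recognition_subspace i0 p" "lorentz_inner t t < 0"
    using assms(1) unfolding timelike_subspace_def timelike_def by blast
  moreover have "g \<in> lorentz_complement (recognition_subspace i0 p)"
    unfolding complement by (rule exI[of _ 0], rule exI[of _ 1]) simp
  ultimately have "lorentz_inner t t < 0" "lorentz_inner t g = 0"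
    unfolding lorentz_complement_def by blast+
  moreover have "g \<noteq> 0" using indep[of 0 1] by auto
  ultimately have "lorentz_inner g g > 0" by (rule orthogonal_to_timelike)
  then show ?thesis using assms(2) by auto
qed

text \<open>
  A space-like subspace is complementary to its Lorentzian complement.  If the form were
  positive semidefinite on both, it would be so on the whole space, where \<open>(1, 0)\<close> is time-like.
\<close>

lemma sign_if_spacelike:
  assumes sp: "spacelike_subspace (recognition_subspace i0 p)" and "\<epsilon> \<in> {1, - 1, 0}"
  shows "\<epsilon> = - 1"
proof (rule ccontr)
  assume "\<epsilon> \<noteq> - 1"
  then have \<epsilon>: "\<epsilon> \<ge> 0" using assms(2) by auto
  define V where "V = recognition_subspace i0 p"
  define W where "W = lorentz_complement V"
  have sub: "subspace V" "subspace W"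
    using sp by (auto simp: V_def W_def spacelike_subspace_def subspace_lorentz_complement)
  have nonneg_V: "lorentz_inner v v \<ge> 0" if "v \<in> V" for v
    using sp that unfolding spacelike_subspace_def spacelike_def V_def
    by (cases "v = 0") (auto intro: less_imp_le)
  have nonneg_W: "lorentz_inner w w \<ge> 0" if w: "w \<in> W" for w
  proof -
    obtain a b where "w = a *\<^sub>R f + b *\<^sub>R g" using w complement unfolding W_def V_def by blast
    then show ?thesis using \<epsilon> by (simp only: lorentz_inner_frame) simp
  qed
  have "V \<inter> W \<subseteq> {0}"
  proof
    fix x assume x: "x \<in> V \<inter> W"
    then have "lorentz_inner x x = 0" unfolding W_def lorentz_complement_def by blast
    then show "x \<in> {0}"
      using sp x unfolding spacelike_subspace_def spacelike_def V_def by auto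
  qed
  then have "dim (V \<inter> W) = 0" by simp
  moreover have "DIM('n minkowski) = CARD('n) + 1" by simp
  ultimately have "dim {x + y |x y. x \<in> V \<and> y \<in> W} = DIM('n minkowski)"
    using dim_sums_Int[OF sub] dim_lorentz_complement[OF sub(1), folded W_def] by linarith
  then have "{x + y |x y. x \<in> V \<and> y \<in> W} = UNIV"
    unfolding dim_eq_full span_eq_iff[THEN iffD2, OF subspace_sums[OF sub]] .
  then obtain v w where vw: "(1, 0) = v + w" "v \<in> V" "w \<in> W" by blast
  have vw0: "lorentz_inner v w = 0" using vw unfolding W_def lorentz_complement_def by blast
  then have "lorentz_inner w v = 0" by (simp add: lorentz_inner_commute)
  with vw0 have "lorentz_inner (v + w) (v + w) \<ge> 0" using nonneg_V nonneg_W vw(2,3) by simp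
  then show False
    unfolding vw(1)[symmetric] by (simp add: lorentz_inner_def)
qed

text \<open>
  On a light-like subspace the form is positive semidefinite with a nonzero null vector \<open>x\<close>, and
  such a vector is orthogonal to the whole subspace.  So \<open>x\<close> also lies in the complement.  Being
  orthogonal to \<open>f\<close>, it is a multiple of \<open>g\<close>, and being orthogonal to \<open>g\<close> it
  forces \<open>\<epsilon> = 0\<close>.
\<close>

lemma sign_if_lightlike:
  assumes li: "lightlike_subspace (recognition_subspace i0 p)" and "\<epsilon> \<in> {1, - 1, 0}"
  shows "\<epsilon> = 0"
proof -
  define V where "V = recognition_subspace i0 p"
  have V: "subspace V" "\<And>v. v \<in> V \<Longrightarrow> \<not> timelike v"
    and "\<exists>x\<in>V. x \<noteq> 0 \<and> \<not> spacelike x"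
    using li unfolding lightlike_subspace_def timelike_subspace_def spacelike_subspace_def V_def
    by blast+
  then obtain x where x: "x \<in> V" "x \<noteq> 0" "\<not> spacelike x" by blast
  have nonneg: "lorentz_inner v v \<ge> 0" if "v \<in> V" for v
    using V(2)[OF that] unfolding timelike_def by (cases "v = 0") auto
  have xx: "lorentz_inner x x = 0"
    using x nonneg[OF x(1)] unfolding spacelike_def by auto
  have "lorentz_inner v x = 0" if v: "v \<in> V" for v
  proof (rule ccontr)
    assume nz: "lorentz_inner v x \<noteq> 0"
    \<comment> \<open>chosen so that the form takes the value -1 at \<open>v + t *\<^sub>R x\<close>\<close>
    define t where "t = - (lorentz_inner v v + 1) / (2 * lorentz_inner v x)"
    have "lorentz_inner (v + t *\<^sub>R x) (v + t *\<^sub>R x) = lorentz_inner v v + t * (2 * lorentz_inner v x)"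
      using xx lorentz_inner_commute[of x v] by simp
    also have "\<dots> = - 1" using nz by (simp add: t_def)
    finally show False
      using nonneg[of "v + t *\<^sub>R x"] V(1) v x(1) by (simp add: subspace_add subspace_scale del: lorentz_inner_simps)
  qed
  then have "x \<in> lorentz_complement V" unfolding lorentz_complement_def by blast
  then obtain a b where ab: "x = a *\<^sub>R f + b *\<^sub>R g" using complement unfolding V_def by blast
  have W: "f \<in> lorentz_complement V" "g \<in> lorentz_complement V"
    unfolding V_def complement
    by (rule exI[of _ 1], rule exI[of _ 0], simp) (rule exI[of _ 0], rule exI[of _ 1], simp)
  then have "lorentz_inner x f = 0" "lorentz_inner x g = 0"
    using x(1) unfolding lorentz_complement_def by blast+
  then have "a = 0" "b * \<epsilon> = 0" unfolding ab by simp_all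
  then show ?thesis using x(2) ab by auto
qed

end

section \<open>Linear diffeomorphisms and topological invariants\<close>

lemma smooth_map_linear:
  fixes f :: "'a::euclidean_space \<Rightarrow> 'b::euclidean_space"
  assumes "linear f"
  shows "smooth_map f"
proof -
  have const: "Ck_map k (\<lambda>_::'a. c::'b)" for k c
    by (induction k arbitrary: c) (auto simp: continuous_on_const)
  have D: "(f has_derivative f) (at x)" for x
    using assms by (simp add: linear_imp_has_derivative)
  have "Ck_map k f" for k
  proof (cases k)
    case 0
    then show ?thesis using assms by (simp add: linear_continuous_on linear_conv_bounded_linear)
  next
    case (Suc m)
    then show ?thesis
      using D const by (auto simp: frechet_derivative_at[OF D, symmetric] differentiable_def)
  qed
  then show ?thesis by (simp add: smooth_map_def)
qed

lemma diffeomorphism_linear: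
  fixes f :: "'a::euclidean_space \<Rightarrow> 'a"
  assumes "linear f" "inj f"
  shows "diffeomorphism f"
proof -
  have "bij f"
    using assms linear_injective_imp_surjective by (auto simp: bij_def)
  moreover from this assms have "linear (inv f)"
    by (metis bij_betw_def inj_iff linear_injective_left_inverse bij_is_surj surj_iff
        comp_assoc comp_id id_comp)
  ultimately show ?thesis
    using assms smooth_map_linear by (auto simp: diffeomorphism_def)
qed

text \<open>
  The inverse of the sought map fixes the Euclidean orthogonal complement of the plane spanned by
  \<open>f\<close> and \<open>g\<close> and sends an orthonormal basis \<open>u\<close>, \<open>v\<close> of that plane to \<open>f\<close>, \<open>g\<close>.
\<close>

lemma orthonormalizing_diffeomorphism:
  fixes f g :: "'a::euclidean_space"
  assumes indep: "\<And>a b. a *\<^sub>R f + b *\<^sub>R g = 0 \<Longrightarrow> a = 0 \<and> b = 0"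
  obtains h :: "'a \<Rightarrow> 'a" where "linear h" "diffeomorphism h"
    "norm (h f) = 1" "norm (h g) = 1" "h f \<bullet> h g = 0"
proof -
  have dim: "dim (span {f, g}) = 2" 
    using independent_pairI[of f g] indep dim_eq_card_independent[of "{f, g}"] by simp
  obtain B where B: "B \<subseteq> span {f, g}" "pairwise orthogonal B" "\<And>x. x \<in> B \<Longrightarrow> norm x = 1"
      "card B = 2" "span B = span {f, g}"
    using orthonormal_basis_subspace[OF subspace_span] dim by metis
  obtain u v where uv: "B = {u, v}" "u \<noteq> v" using B(4) by (meson card_2_iff)
  have on: "norm u = 1" "norm v = 1" "u \<bullet> v = 0"
    using B(2,3) uv by (auto simp: pairwise_insert orthogonal_def)
  have uu: "u \<bullet> u = 1" "v \<bullet> v = 1" "v \<bullet> u = 0"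
    using on by (auto simp: dot_square_norm inner_commute)
  have fg: "f \<in> span {u, v}" "g \<in> span {u, v}"
    using B(5) uv by (auto intro: span_base)
  define G where "G x = (x - (x \<bullet> u) *\<^sub>R u - (x \<bullet> v) *\<^sub>R v) + ((x \<bullet> u) *\<^sub>R f + (x \<bullet> v) *\<^sub>R g)" for x
  have G: "linear G"
    by (rule linearI) (simp_all add: G_def algebra_simps inner_add_left)
  have "x = 0" if "G x = 0" for x
  proof -
    define r where "r = x - (x \<bullet> u) *\<^sub>R u - (x \<bullet> v) *\<^sub>R v"
    have "r \<bullet> u = 0" "r \<bullet> v = 0"
      using on uu by (auto simp: r_def inner_diff_left)
    then have "orthogonal r y" if "y \<in> span {u, v}" for y
      using orthogonal_to_span[OF that, of r] by (auto simp: orthogonal_def)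
    then have "r \<bullet> f = 0" "r \<bullet> g = 0" using fg by (auto simp: orthogonal_def)
    moreover have r: "r = - ((x \<bullet> u) *\<^sub>R f + (x \<bullet> v) *\<^sub>R g)"
      using that unfolding G_def r_def[symmetric] by (simp only: eq_neg_iff_add_eq_0)
    moreover have "r \<bullet> r = r \<bullet> - ((x \<bullet> u) *\<^sub>R f + (x \<bullet> v) *\<^sub>R g)"
      using r by (rule arg_cong)
    ultimately have "r \<bullet> r = 0" by (simp add: inner_diff_right inner_add_right)
    then have "r = 0" by simp
    with r have "(x \<bullet> u) *\<^sub>R f + (x \<bullet> v) *\<^sub>R g = 0" by (metis neg_equal_0_iff_equal)
    then have "x \<bullet> u = 0 \<and> x \<bullet> v = 0" by (rule indep)
    then show "x = 0" using \<open>r = 0\<close> by (simp add: r_def)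
  qed
  then have inj: "inj G" using G by (simp add: linear_injective_0)
  then have dG: "diffeomorphism G" using G by (rule diffeomorphism_linear[rotated])
  have bij: "bij G" using dG by (simp add: diffeomorphism_def)
  have "linear (inv G)"
    by (metis G bij bij_betw_def inj_iff linear_injective_left_inverse surj_iff
        comp_assoc comp_id id_comp)
  moreover have "diffeomorphism (inv G)"
    using dG bij by (auto simp: diffeomorphism_def bij_imp_bij_inv inv_inv_eq)
  moreover have "G u = f" "G v = g" using on uu by (auto simp: G_def)
  then have "inv G f = u" "inv G g = v" using inj by (metis inv_f_f)+
  ultimately show ?thesis using that[of "inv G"] on by simp
qed

lemma diffeomorphism_continuous:
  assumes "diffeomorphism h"
  shows "continuous_on S h" "continuous_on T (inv h)"
  using assms unfolding diffeomorphism_def smooth_map_def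
  by (metis Ck_map.simps(1) continuous_on_subset subset_UNIV)+

lemma
  fixes h :: "'a::euclidean_space \<Rightarrow> 'b::euclidean_space"
  assumes "diffeomorphism h"
  shows compact_diffeomorphism_image: "compact (h ` F) \<longleftrightarrow> compact F"
    and connected_diffeomorphism_image: "connected (h ` F) \<longleftrightarrow> connected F"
proof -
  have "inv h ` h ` F = F"
    using assms by (simp add: diffeomorphism_def bij_is_inj image_inv_f_f)
  then show "compact (h ` F) \<longleftrightarrow> compact F" "connected (h ` F) \<longleftrightarrow> connected F"
    using diffeomorphism_continuous[OF assms] compact_continuous_image connected_continuous_image
    by metis+
qed

section \<open>Plane curves\<close>

lemma planar_locus_swap: "planar_locus E C \<longleftrightarrow> planar_locus (\<lambda>s t. E t s) C"
proof -
  have "planar_locus (\<lambda>s t. E t s) C" if "planar_locus E C" for E and C :: "'a::euclidean_space set"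
  proof -
    obtain c u v where on: "norm v = 1" "norm u = 1" "v \<bullet> u = 0"
      and C: "C = {c + s *\<^sub>R u + t *\<^sub>R v | s t. E s t}"
      using \<open>planar_locus E C\<close> unfolding planar_locus_def by (auto simp: inner_commute)
    have "C = {c + s *\<^sub>R v + t *\<^sub>R u | s t. E t s}"
      unfolding C by (simp add: set_eq_iff add.assoc add.commute[of "_ *\<^sub>R v" "_ *\<^sub>R u"]) blast
    with on show ?thesis unfolding planar_locus_def by blast
  qed
  from this[of E] this[of "\<lambda>s t. E t s"] show ?thesis by blast
qed

lemma compact_circle:
  fixes C :: "'a::euclidean_space set"
  assumes "is_circle C"
  shows "compact C"
proof -
  obtain r c u v where "r > 0" and C: "C = {c + s *\<^sub>R u + t *\<^sub>R v | s t. s\<^sup>2 + t\<^sup>2 = r\<^sup>2}"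
    using assms unfolding is_circle_def planar_locus_def by blast
  have "(s, t) \<in> sphere 0 r \<longleftrightarrow> s\<^sup>2 + t\<^sup>2 = r\<^sup>2" for s t
    using \<open>r > 0\<close> by (auto simp: norm_Pair real_sqrt_unique)
  then have "C = (\<lambda>z. c + fst z *\<^sub>R u + snd z *\<^sub>R v) ` sphere 0 r"
    unfolding C image_def Bex_def split_paired_Ex by simp blast
  then show ?thesis
    by (auto intro!: compact_continuous_image continuous_intros)
qed

text \<open>
  Used to see that a curve is unbounded: some coordinate takes every real value on it.
\<close>

lemma not_compact_if_surj_inner:
  fixes C :: "'a::euclidean_space set"
  assumes "\<And>t. \<exists>x\<in>C. (x - c) \<bullet> w = t"
  shows "\<not> compact C"
proof
  assume "compact C"
  then have "compact ((\<lambda>x. (x - c) \<bullet> w) ` C)"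
    by (intro compact_continuous_image continuous_intros)
  moreover have "(\<lambda>x. (x - c) \<bullet> w) ` C = UNIV" using assms by (auto simp: image_iff) metis
  ultimately show False by (metis not_bounded_UNIV compact_imp_bounded)
qed

text \<open>
  The coordinate along the transverse axis takes the values \<open>a\<close> and \<open>- a\<close> but not 0, which separates
  the two branches.
\<close>

lemma
  fixes C :: "'a::euclidean_space set"
  assumes "is_equilateral_hyperbola C"
  shows not_compact_equilateral_hyperbola: "\<not> compact C"
    and not_connected_equilateral_hyperbola: "\<not> connected C"
proof -
  obtain a c u v where "a > 0" and on: "norm u = 1" "norm v = 1" "u \<bullet> v = 0"
    and C: "C = {c + s *\<^sub>R u + t *\<^sub>R v | s t. s\<^sup>2 - t\<^sup>2 = a\<^sup>2}"
    using assms unfolding is_equilateral_hyperbola_def planar_locus_def by blast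
  have uu: "u \<bullet> u = 1" "v \<bullet> v = 1" "v \<bullet> u = 0"
    using on by (auto simp: dot_square_norm inner_commute)
  show "\<not> compact C"
  proof (rule not_compact_if_surj_inner)
    fix t
    have "c + sqrt (a\<^sup>2 + t\<^sup>2) *\<^sub>R u + t *\<^sub>R v \<in> C" unfolding C
      by (intro CollectI exI[of _ "sqrt (a\<^sup>2 + t\<^sup>2)"] exI[of _ t]) simp
    then show "\<exists>x\<in>C. (x - c) \<bullet> v = t"
      by (rule rev_bexI) (simp add: uu on inner_add_left inner_diff_left)
  qed
  show "\<not> connected C"
  proof
    assume "connected C"
    then have "connected ((\<lambda>x. (x - c) \<bullet> u) ` C)"
      by (intro connected_continuous_image continuous_intros)
    moreover have "s \<in> (\<lambda>x. (x - c) \<bullet> u) ` C" if "s\<^sup>2 = a\<^sup>2" for s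
    proof (rule image_eqI)
      show "c + s *\<^sub>R u + 0 *\<^sub>R v \<in> C" unfolding C
        using that by (intro CollectI exI[of _ s] exI[of _ 0]) simp
    qed (simp add: uu on inner_add_left inner_diff_left)
    then have "a \<in> (\<lambda>x. (x - c) \<bullet> u) ` C" "- a \<in> (\<lambda>x. (x - c) \<bullet> u) ` C" by simp_all
    ultimately have "0 \<in> (\<lambda>x. (x - c) \<bullet> u) ` C"
      using \<open>a > 0\<close> connectedD_interval[of _ "- a" a 0] by simp
    then obtain s t where "s\<^sup>2 - t\<^sup>2 = a\<^sup>2" "s = 0"
      unfolding C by (auto simp: uu on inner_add_left inner_diff_left)
    then show False using \<open>a > 0\<close> by (smt (verit) zero_le_power2 zero_less_power power_zero_numeral)
  qed
qed

lemma
  fixes C :: "'a::euclidean_space set"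
  assumes "is_parabola C"
  shows not_compact_parabola: "\<not> compact C" and connected_parabola: "connected C"
proof -
  obtain a c u v where on: "norm u = 1" "norm v = 1" "u \<bullet> v = 0"
    and C: "C = {c + s *\<^sub>R u + t *\<^sub>R v | s t. t = a * s\<^sup>2}"
    using assms unfolding is_parabola_def planar_locus_def by blast
  have uu: "u \<bullet> u = 1" "v \<bullet> u = 0"
    using on by (auto simp: dot_square_norm inner_commute)
  show "\<not> compact C"
  proof (rule not_compact_if_surj_inner)
    fix s
    have "c + s *\<^sub>R u + (a * s\<^sup>2) *\<^sub>R v \<in> C" unfolding C by blast
    then show "\<exists>x\<in>C. (x - c) \<bullet> u = s"
      by (rule rev_bexI) (simp add: uu inner_add_left inner_diff_left)
  qed
  have "C = range (\<lambda>s. c + s *\<^sub>R u + (a * s\<^sup>2) *\<^sub>R v)" unfolding C by auto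
  then show "connected C"
    by (auto intro!: connected_continuous_image continuous_intros)
qed

lemma not_compact_parallel_line_pair:
  fixes C :: "'a::euclidean_space set"
  assumes "is_parallel_line_pair C"
  shows "\<not> compact C"
proof -
  obtain a b c u v where on: "norm u = 1" "norm v = 1" "u \<bullet> v = 0"
    and C: "C = {c + s *\<^sub>R u + t *\<^sub>R v | s t. t = a \<or> t = b}"
    using assms unfolding is_parallel_line_pair_def planar_locus_def by blast
  show "\<not> compact C"
  proof (rule not_compact_if_surj_inner)
    fix s
    have "c + s *\<^sub>R u + a *\<^sub>R v \<in> C" unfolding C by blast
    then show "\<exists>x\<in>C. (x - c) \<bullet> u = s"
      using on by (intro rev_bexI)
        (auto simp: inner_commute[of v u] dot_square_norm inner_add_left inner_diff_left)
  qed
qed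

text \<open>
  The coordinate transverse to the lines takes only two values on the pair, so it is constant on a
  connected subset.
\<close>

lemma collinear_connected_subset_of_parallel_line_pair:
  fixes C :: "'a::euclidean_space set"
  assumes "is_parallel_line_pair C" "connected S" "S \<subseteq> C"
  shows "collinear S"
proof -
  obtain a b c u v where on: "norm u = 1" "norm v = 1" "u \<bullet> v = 0"
    and C: "C = {c + s *\<^sub>R u + t *\<^sub>R v | s t. t = a \<or> t = b}"
    using assms(1) unfolding is_parallel_line_pair_def planar_locus_def by blast
  define T where "T = (\<lambda>x. (x - c) \<bullet> v) ` S"
  have T: "connected T"
    unfolding T_def using assms(2) by (intro connected_continuous_image continuous_intros)
  have rep: "\<exists>s. x = c + s *\<^sub>R u + ((x - c) \<bullet> v) *\<^sub>R v \<and> (x - c) \<bullet> v \<in> {a, b}" if x: "x \<in> S" for x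
  proof -
    obtain s t where "x = c + s *\<^sub>R u + t *\<^sub>R v" "t \<in> {a, b}"
      using x \<open>S \<subseteq> C\<close> C by blast
    moreover from this(1) have "(x - c) \<bullet> v = t"
      using on by (simp add: dot_square_norm inner_add_left inner_diff_left)
    ultimately show ?thesis by metis
  qed
  then have "T \<subseteq> {a, b}" unfolding T_def by blast
  then have "finite T" by (rule finite_subset) simp
  then obtain t where "T \<subseteq> {t}" using T connected_finite_iff_sing by blast
  then have "\<exists>s. x = c + s *\<^sub>R u + t *\<^sub>R v" if "x \<in> S" for x
    using rep[OF that] that unfolding T_def by blast
  then show ?thesis
    unfolding collinear_def
    by (intro exI[of _ u] ballI) (metis add_diff_cancel_left add_diff_cancel_right scaleR_left.diff)
qed

section \<open>Straightening of hyperbolas\<close>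

lemma diffeomorphism_derivative:
  fixes h :: "'a::euclidean_space \<Rightarrow> 'b::euclidean_space"
  assumes "diffeomorphism h"
  obtains D where "(h has_derivative D) (at q)" "inj D"
proof -
  have "Ck_map 1 h" "Ck_map 1 (inv h)" and bij: "bij h"
    using assms unfolding diffeomorphism_def smooth_map_def by blast+
  then obtain D D' where D: "(h has_derivative D) (at q)" "(inv h has_derivative D') (at (h q))"
    unfolding differentiable_def One_nat_def Ck_map.simps by blast
  then have "(inv h \<circ> h has_derivative D' \<circ> D) (at q)" by (rule diff_chain_at)
  moreover have "inv h \<circ> h = id" using bij by (simp add: bij_is_inj)
  ultimately have "D' \<circ> D = id" using has_derivative_unique[OF _ has_derivative_id] by metis
  then have "inj D" by (metis inj_on_id inj_on_imageI2)
  with D(1) that show ?thesis by blast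
qed

text \<open>
  The branches \<open>s * t = \<sigma>\<^sup>2\<close> are rescaled copies of one branch, shrinking towards the point
  \<open>q\<close> where the asymptotes cross.  If \<open>h\<close> made all of them straight, then so would the blow-ups
  \<open>(h (q + \<sigma> w) - h q) / \<sigma>\<close> with the branch \<open>s * t = 1\<close>, and in the limit \<open>\<sigma> \<rightarrow> 0\<close> so would
  the derivative of \<open>h\<close> at \<open>q\<close>.  But an injective linear map cannot straighten a hyperbola.  Three points
  of the branch suffice; collinearity is expressed by equality in the Cauchy-Schwarz inequality, which
  passes to limits.
\<close>

lemma not_collinear_hyperbola_branches:
  fixes h :: "'a::euclidean_space \<Rightarrow> 'b::euclidean_space"
  assumes h: "diffeomorphism h"
    and indep: "\<And>a b. a *\<^sub>R e + b *\<^sub>R g = 0 \<Longrightarrow> a = 0 \<and> b = 0"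
  shows "\<exists>\<sigma>>0. \<not> collinear (h ` {q + s *\<^sub>R e + t *\<^sub>R g | s t. s > 0 \<and> t > 0 \<and> s * t = \<sigma>\<^sup>2})"
proof (rule ccontr)
  assume "\<not> ?thesis"
  then have col: "collinear (h ` {q + s *\<^sub>R e + t *\<^sub>R g | s t. s > 0 \<and> t > 0 \<and> s * t = \<sigma>\<^sup>2})"
    if "\<sigma> > 0" for \<sigma> using that by blast
  obtain D where D: "(h has_derivative D) (at q)" "inj D" using diffeomorphism_derivative[OF h] .
  have lin: "linear D" using D(1) by (rule has_derivative_linear)
  \<comment> \<open>points of the branch \<open>s * t = 1\<close>; the parameters 1, 2 and 1/2 give three that are not collinear\<close>
  define w where "w k = k *\<^sub>R e + (1 / k) *\<^sub>R g" for k :: real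
  define X where "X k \<sigma> = (1 / \<sigma>) *\<^sub>R (h (q + \<sigma> *\<^sub>R w k) - h q)" for k \<sigma>
  have lim: "(X k \<longlongrightarrow> D (w k)) (at_right 0)" for k
  proof -
    have "(h has_derivative D) (at (q + 0 *\<^sub>R w k))" using D(1) by simp
    moreover have "((\<lambda>\<sigma>. q + \<sigma> *\<^sub>R w k) has_derivative (\<lambda>\<sigma>. \<sigma> *\<^sub>R w k)) (at 0)"
      by (auto intro!: derivative_eq_intros)
    ultimately have "((\<lambda>\<sigma>. h (q + \<sigma> *\<^sub>R w k)) has_derivative (\<lambda>\<sigma>. D (\<sigma> *\<^sub>R w k))) (at 0)"
      using has_derivative_compose by blast
    then have "((\<lambda>\<sigma>. h (q + \<sigma> *\<^sub>R w k)) has_vector_derivative D (w k)) (at 0)"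
      by (simp add: has_vector_derivative_def linear_scale[OF lin])
    then have "((\<lambda>\<sigma>. norm (h (q + \<sigma> *\<^sub>R w k) - h q - \<sigma> *\<^sub>R D (w k)) / norm \<sigma>) \<longlongrightarrow> 0) (at 0)"
      by (simp add: has_vector_derivative_def has_derivative_iff_norm)
    moreover have "norm (h (q + \<sigma> *\<^sub>R w k) - h q - \<sigma> *\<^sub>R D (w k)) / norm \<sigma> = norm (X k \<sigma> - D (w k))"
      if "\<sigma> \<noteq> 0" for \<sigma>
    proof -
      have "X k \<sigma> - D (w k) = (1 / \<sigma>) *\<^sub>R (h (q + \<sigma> *\<^sub>R w k) - h q - \<sigma> *\<^sub>R D (w k))"
        using that by (simp add: X_def scaleR_diff_right)
      then show ?thesis by (simp add: divide_inverse mult.commute)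
    qed
    then have "\<forall>\<^sub>F \<sigma> in at 0. norm (h (q + \<sigma> *\<^sub>R w k) - h q - \<sigma> *\<^sub>R D (w k)) / norm \<sigma> = norm (X k \<sigma> - D (w k))"
      by (simp add: eventually_at_filter)
    ultimately have "((\<lambda>\<sigma>. norm (X k \<sigma> - D (w k))) \<longlongrightarrow> 0) (at 0)"
      by (rule Lim_transform_eventually)
    then have "(X k \<longlongrightarrow> D (w k)) (at 0)"
      by (simp add: tendsto_norm_zero_iff LIM_zero_cancel)
    then show ?thesis by (simp add: filterlim_at_split)
  qed
  have eq: "\<bar>(X 2 \<sigma> - X 1 \<sigma>) \<bullet> (X (1/2) \<sigma> - X 1 \<sigma>)\<bar> = norm (X 2 \<sigma> - X 1 \<sigma>) * norm (X (1/2) \<sigma> - X 1 \<sigma>)"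
    if "\<sigma> > 0" for \<sigma>
  proof -
    define P where "P k = h (q + \<sigma> *\<^sub>R w k)" for k
    have mem: "P k \<in> h ` {q + s *\<^sub>R e + t *\<^sub>R g | s t. s > 0 \<and> t > 0 \<and> s * t = \<sigma>\<^sup>2}" if "k > 0" for k
      unfolding P_def
    proof (intro imageI CollectI exI conjI)
      show "q + \<sigma> *\<^sub>R w k = q + (\<sigma> * k) *\<^sub>R e + (\<sigma> / k) *\<^sub>R g"
        by (simp add: w_def scaleR_add_right)
    qed (use \<open>\<sigma> > 0\<close> that in \<open>auto simp: power2_eq_square\<close>)
    have "collinear {P 2, P 1, P (1/2)}"
      by (rule collinear_subset[OF col[OF that]]) (auto intro!: mem)
    then have "collinear {0, P 2 - P 1, P (1/2) - P 1}"
      by (simp add: collinear_3[of "P 2"])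
    then have "\<bar>(P 2 - P 1) \<bullet> (P (1/2) - P 1)\<bar> = norm (P 2 - P 1) * norm (P (1/2) - P 1)"
      by (simp only: norm_cauchy_schwarz_equal)
    moreover have "X k \<sigma> - X 1 \<sigma> = (1/\<sigma>) *\<^sub>R (P k - P 1)" for k
      by (simp add: X_def P_def algebra_simps)
    ultimately show ?thesis using that
      by (simp add: abs_mult)
  qed
  define a b where "a = w 2 - w 1" and "b = w (1/2) - w 1"
  have DD: "D (w 2) - D (w 1) = D a" "D (w (1/2)) - D (w 1) = D b"
    by (simp_all add: a_def b_def linear_diff[OF lin])
  let ?inner = "\<lambda>\<sigma>. \<bar>(X 2 \<sigma> - X 1 \<sigma>) \<bullet> (X (1/2) \<sigma> - X 1 \<sigma>)\<bar>"
  let ?norms = "\<lambda>\<sigma>. norm (X 2 \<sigma> - X 1 \<sigma>) * norm (X (1/2) \<sigma> - X 1 \<sigma>)"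
  have "(?inner \<longlongrightarrow> \<bar>D a \<bullet> D b\<bar>) (at_right 0)"
    unfolding DD[symmetric] by (intro tendsto_intros lim)
  moreover have "\<forall>\<^sub>F \<sigma> in at_right 0. ?inner \<sigma> = ?norms \<sigma>"
    using eq by (auto simp: eventually_at_filter)
  ultimately have "(?norms \<longlongrightarrow> \<bar>D a \<bullet> D b\<bar>) (at_right 0)"
    by (rule Lim_transform_eventually)
  moreover have "(?norms \<longlongrightarrow> norm (D a) * norm (D b)) (at_right 0)"
    unfolding DD[symmetric] by (intro tendsto_intros lim)
  ultimately have "\<bar>D a \<bullet> D b\<bar> = norm (D a) * norm (D b)"
    by (rule tendsto_unique[OF trivial_limit_at_right_real])
  then have "collinear {0, D a, D b}" by (simp only: norm_cauchy_schwarz_equal)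
  then have "\<exists>x y. (x \<noteq> 0 \<or> y \<noteq> 0) \<and> D (x *\<^sub>R a + y *\<^sub>R b) = 0"
  proof -
    assume "collinear {0, D a, D b}"
    then consider "D a = 0" | "D b = 0" | k where "D b = k *\<^sub>R D a"
      unfolding collinear_lemma by blast
    then show ?thesis
    proof cases
      case 1 then show ?thesis by (intro exI[of _ 1] exI[of _ 0]) simp
    next
      case 2 then show ?thesis by (intro exI[of _ 0] exI[of _ 1]) simp
    next
      case 3 then show ?thesis
        by (intro exI[of _ "-k"] exI[of _ 1]) (simp add: linear_diff[OF lin] linear_scale[OF lin])
    qed
  qed
  then obtain x y where xy: "x \<noteq> 0 \<or> y \<noteq> 0" "D (x *\<^sub>R a + y *\<^sub>R b) = 0" by blast
  then have "x *\<^sub>R a + y *\<^sub>R b = 0" using D(2) lin by (metis linear_0 injD)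
  moreover have w: "w k - w 1 = (k - 1) *\<^sub>R e + (1 / k - 1) *\<^sub>R g" for k
    by (simp add: w_def algebra_simps)
  moreover have "x *\<^sub>R (\<alpha> *\<^sub>R e + \<beta> *\<^sub>R g) + y *\<^sub>R (\<gamma> *\<^sub>R e + \<delta> *\<^sub>R g)
      = (x * \<alpha> + y * \<gamma>) *\<^sub>R e + (x * \<beta> + y * \<delta>) *\<^sub>R g" for \<alpha> \<beta> \<gamma> \<delta>
    by (simp add: algebra_simps)
  ultimately have "x * (2 - 1) + y * (1/2 - 1) = 0 \<and> x * (1/2 - 1) + y * (1/(1/2) - 1) = 0"
    unfolding a_def b_def w by (metis indep)
  then show False using xy(1) by simp
qed

section \<open>Normal forms of the fibers\<close>

text \<open>
  Substitution of coordinates, which turns completing the square in an equation into moving the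
  centre of the curve.
\<close>

lemma frame_locus_shift:
  fixes f g :: "'a::real_vector"
  shows "{x + s *\<^sub>R f + t *\<^sub>R g | s t. E (s + a) (t + b)}
    = {(x - a *\<^sub>R f - b *\<^sub>R g) + s *\<^sub>R f + t *\<^sub>R g | s t. E s t}" (is "?A = ?B")
proof (intro set_eqI iffI)
  fix z assume "z \<in> ?A"
  then obtain s t where "z = x + s *\<^sub>R f + t *\<^sub>R g" "E (s + a) (t + b)" by blast
  moreover from this(1) have "z = (x - a *\<^sub>R f - b *\<^sub>R g) + (s + a) *\<^sub>R f + (t + b) *\<^sub>R g"
    by (simp add: algebra_simps)
  ultimately show "z \<in> ?B" by blast
next
  fix z assume "z \<in> ?B"
  then obtain s t where "z = (x - a *\<^sub>R f - b *\<^sub>R g) + s *\<^sub>R f + t *\<^sub>R g" "E s t" by blast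
  then have "z = x + (s - a) *\<^sub>R f + (t - b) *\<^sub>R g" "E (s - a + a) (t - b + b)"
    by (simp_all add: algebra_simps)
  then show "z \<in> ?A" by blast
qed

context complement_frame
begin

text \<open>
  Completing both squares moves the base point to the centre of the conic.  For \<open>R = 0\<close> the centre
  itself would be a singular point of the fiber.
\<close>

lemma nonsingular_central_conic:
  assumes \<epsilon>: "\<epsilon> * \<epsilon> = 1" and F: "nonsingular_fiber L F"
  obtains c R where "R \<noteq> 0" "F = {c + s *\<^sub>R f + t *\<^sub>R g | s t. s\<^sup>2 + \<epsilon> * t\<^sup>2 = R}"
proof -
  obtain x where x: "F = L -` {L x}" and ns: "\<And>z. z \<in> F \<Longrightarrow> \<not> singular_point L z"
    using F unfolding nonsingular_fiber_def by blast
  define b1 b2 where b: "b1 = lorentz_inner (x - p i0) f" "b2 = lorentz_inner (x - p i0) g"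
  define c where "c = x - b1 *\<^sub>R f - (\<epsilon> * b2) *\<^sub>R g"
  define R where "R = b1\<^sup>2 + \<epsilon> * b2\<^sup>2"
  have eq: "a\<^sup>2 + \<epsilon> * d\<^sup>2 + 2 * (a * b1 + d * b2) = 0
      \<longleftrightarrow> (a + b1)\<^sup>2 + \<epsilon> * (d + \<epsilon> * b2)\<^sup>2 = R" for a d
  proof -
    have "\<epsilon> * (d + \<epsilon> * b2)\<^sup>2 = \<epsilon> * d\<^sup>2 + 2 * (\<epsilon> * \<epsilon>) * d * b2 + (\<epsilon> * \<epsilon>) * \<epsilon> * b2\<^sup>2"
      by (simp add: power2_eq_square algebra_simps)
    then show ?thesis unfolding \<epsilon> R_def by (simp add: power2_eq_square algebra_simps)
  qed
  have F_eq: "F = {c + s *\<^sub>R f + t *\<^sub>R g | s t. s\<^sup>2 + \<epsilon> * t\<^sup>2 = R}"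
    unfolding x fiber_eq b[symmetric] eq c_def
    by (rule frame_locus_shift[where E = "\<lambda>s t. s\<^sup>2 + \<epsilon> * t\<^sup>2 = R"])
  moreover have "R \<noteq> 0"
  proof
    assume "R = 0"
    have "c \<in> F"
      unfolding F_eq \<open>R = 0\<close> by (intro CollectI exI[of _ 0]) simp
    moreover have "c - p i0 = (x - p i0) - b1 *\<^sub>R f - (\<epsilon> * b2) *\<^sub>R g"
      by (simp add: c_def)
    then have "lorentz_inner (c - p i0) f = 0" "lorentz_inner (c - p i0) g = b2 - (\<epsilon> * \<epsilon>) * b2"
      by (simp_all only: b lorentz_inner_simps lorentz_inner_fg) simp_all
    ultimately show False using ns \<epsilon> by (simp add: singular_point_iff)
  qed
  ultimately show ?thesis using that by blast
qed

lemma central_conic_nonsingular: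
  assumes \<epsilon>: "\<epsilon> * \<epsilon> = 1" and "R \<noteq> 0" and "s0\<^sup>2 + \<epsilon> * t0\<^sup>2 = R"
  shows "nonsingular_fiber L {p i0 + s *\<^sub>R f + t *\<^sub>R g | s t. s\<^sup>2 + \<epsilon> * t\<^sup>2 = R}"
    (is "nonsingular_fiber L ?C")
proof -
  have in1: "lorentz_inner (p i0 + s *\<^sub>R f + t *\<^sub>R g - p i0) f = s" for s t by simp
  have in2: "lorentz_inner (p i0 + s *\<^sub>R f + t *\<^sub>R g - p i0) g = t * \<epsilon>" for s t by simp
  define x where "x = p i0 + s0 *\<^sub>R f + t0 *\<^sub>R g"
  have eq: "a\<^sup>2 + \<epsilon> * d\<^sup>2 + 2 * (a * s0 + d * (t0 * \<epsilon>)) = 0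
      \<longleftrightarrow> (a + s0)\<^sup>2 + \<epsilon> * (d + t0)\<^sup>2 = R" for a d
    unfolding assms(3)[symmetric] by (simp add: power2_eq_square algebra_simps)
  have "L -` {L x} = ?C"
  proof -
    have "L -` {L x} = {x + a *\<^sub>R f + d *\<^sub>R g | a d. (a + s0)\<^sup>2 + \<epsilon> * (d + t0)\<^sup>2 = R}"
      unfolding fiber_eq unfolding x_def in1 in2 eq ..
    also have "\<dots> = {(x - s0 *\<^sub>R f - t0 *\<^sub>R g) + s *\<^sub>R f + t *\<^sub>R g | s t. s\<^sup>2 + \<epsilon> * t\<^sup>2 = R}"
      by (rule frame_locus_shift[where E = "\<lambda>s t. s\<^sup>2 + \<epsilon> * t\<^sup>2 = R"])
    also have "x - s0 *\<^sub>R f - t0 *\<^sub>R g = p i0" by (simp add: x_def)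
    finally show ?thesis .
  qed
  moreover have "\<not> singular_point L z" if z_in: "z \<in> ?C" for z
  proof -
    obtain s t where z: "z = p i0 + s *\<^sub>R f + t *\<^sub>R g" and R: "s\<^sup>2 + \<epsilon> * t\<^sup>2 = R" using z_in by blast
    have "\<epsilon> \<noteq> 0" using \<epsilon> by auto
    then show ?thesis
      using R \<open>R \<noteq> 0\<close> unfolding singular_point_iff z in1 in2 by auto
  qed
  ultimately show ?thesis unfolding nonsingular_fiber_def by blast
qed

text \<open>
  For \<open>\<epsilon> = 0\<close> the equation is quadratic along \<open>f\<close> only, so it can be solved for the
  coordinate along \<open>g\<close>.
\<close>

lemma degenerate_fiber_parabola:
  assumes \<epsilon>: "\<epsilon> = 0" and "lorentz_inner (x - p i0) g \<noteq> 0"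
  obtains c k where "k \<noteq> 0" "L -` {L x} = {c + s *\<^sub>R f + t *\<^sub>R g | s t. t = k * s\<^sup>2}"
proof -
  define b1 b2 where b: "b1 = lorentz_inner (x - p i0) f" "b2 = lorentz_inner (x - p i0) g"
  have fiber: "L -` {L x} = {x + s *\<^sub>R f + t *\<^sub>R g | s t. s\<^sup>2 + 2 * (s * b1 + t * b2) = 0}"
    unfolding fiber_eq b \<epsilon> by simp
  have b2: "b2 \<noteq> 0" using assms(2) by (simp add: b)
  define k c where "k = - 1 / (2 * b2)" and "c = x - b1 *\<^sub>R f - (k * b1\<^sup>2) *\<^sub>R g"
  have eq: "s\<^sup>2 + 2 * (s * b1 + t * b2) = 0 \<longleftrightarrow> t + k * b1\<^sup>2 = k * (s + b1)\<^sup>2" for s t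
  proof -
    have k: "2 * b2 * k = - 1" using b2 by (simp add: k_def)
    have "2 * b2 * (t + k * b1\<^sup>2 - k * (s + b1)\<^sup>2)
        = 2 * b2 * t - (2 * b2 * k) * (s\<^sup>2 + 2 * s * b1)"
      by (simp add: power2_eq_square algebra_simps)
    also have "\<dots> = s\<^sup>2 + 2 * (s * b1 + t * b2)" unfolding k by simp
    finally have "s\<^sup>2 + 2 * (s * b1 + t * b2) = 0 \<longleftrightarrow> t + k * b1\<^sup>2 - k * (s + b1)\<^sup>2 = 0"
      using b2 by (metis mult_eq_0_iff zero_neq_numeral)
    then show ?thesis by simp
  qed
  have "L -` {L x} = {c + s *\<^sub>R f + t *\<^sub>R g | s t. t = k * s\<^sup>2}"
    unfolding fiber eq c_def by (rule frame_locus_shift[where E = "\<lambda>s t. t = k * s\<^sup>2"])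
  moreover have "k \<noteq> 0" using b2 by (simp add: k_def)
  ultimately show ?thesis using that by blast
qed

text \<open>
  The coordinate along \<open>g\<close> drops out of the equation, and what remains factors.
\<close>

lemma degenerate_fiber_line_pair:
  assumes \<epsilon>: "\<epsilon> = 0" and "lorentz_inner (x - p i0) g = 0"
  obtains c where "L -` {L x} = {c + s *\<^sub>R f + t *\<^sub>R g | s t.
    s = lorentz_inner (x - p i0) f \<or> s = - lorentz_inner (x - p i0) f}"
proof -
  define b1 b2 where b: "b1 = lorentz_inner (x - p i0) f" "b2 = lorentz_inner (x - p i0) g"
  have fiber: "L -` {L x} = {x + s *\<^sub>R f + t *\<^sub>R g | s t. s\<^sup>2 + 2 * (s * b1 + t * b2) = 0}"
    unfolding fiber_eq b \<epsilon> by simp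
  have b2: "b2 = 0" using assms(2) by (simp add: b)
  have eq: "s\<^sup>2 + 2 * (s * b1 + t * b2) = 0 \<longleftrightarrow> s + b1 = b1 \<or> s + b1 = - b1" for s t
  proof -
    have "s\<^sup>2 + 2 * (s * b1 + t * b2) = s * (s + 2 * b1)"
      using b2 by (simp add: power2_eq_square algebra_simps)
    then show ?thesis by auto
  qed
  have "L -` {L x} = {x - b1 *\<^sub>R f - 0 *\<^sub>R g + s *\<^sub>R f + t *\<^sub>R g | s t. s = b1 \<or> s = - b1}"
    unfolding fiber eq by (rule frame_locus_shift[where E = "\<lambda>s t. s = b1 \<or> s = - b1" and b = 0])
  then show ?thesis using that unfolding b by blast
qed

end

section \<open>Images of the fibers under diffeomorphisms\<close>

lemma linear_image_frame:
  assumes "linear h"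
  shows "h ` {c + s *\<^sub>R f + t *\<^sub>R g | s t. E s t} = {h c + s *\<^sub>R h f + t *\<^sub>R h g | s t. E s t}"
proof -
  have "h (c + s *\<^sub>R f + t *\<^sub>R g) = h c + s *\<^sub>R h f + t *\<^sub>R h g" for s t
    by (simp add: linear_add[OF assms] linear_scale[OF assms])
  then show ?thesis unfolding image_def by (simp add: set_eq_iff) metis
qed

lemma image_planar_locus:
  fixes f g :: "'a::euclidean_space"
  assumes h: "linear h" "norm (h f) = 1" "norm (h g) = 1" "h f \<bullet> h g = 0"
  shows "planar_locus E (h ` {c + s *\<^sub>R f + t *\<^sub>R g | s t. E s t})"
  unfolding planar_locus_def linear_image_frame[OF h(1)] using h(2-) by blast

lemma is_parabola_image:
  fixes f g :: "'a::euclidean_space"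
  assumes h: "linear h" "norm (h f) = 1" "norm (h g) = 1" "h f \<bullet> h g = 0" and "k \<noteq> 0"
  shows "is_parabola (h ` {c + s *\<^sub>R f + t *\<^sub>R g | s t. t = k * s\<^sup>2})"
proof (cases "k > 0")
  case True
  then show ?thesis
    using image_planar_locus[OF h, of "\<lambda>s t. t = k * s\<^sup>2"] unfolding is_parabola_def by blast
next
  case False
  have "h ` {c + s *\<^sub>R f + t *\<^sub>R g | s t. t = k * s\<^sup>2}
      = {h c + s *\<^sub>R h f + t *\<^sub>R (- h g) | s t. t = - k * s\<^sup>2}"
    unfolding linear_image_frame[OF h(1)] by simp
  moreover have "norm (- h g) = 1" "h f \<bullet> (- h g) = 0" using h by simp_all
  ultimately have "planar_locus (\<lambda>s t. t = - k * s\<^sup>2) (h ` {c + s *\<^sub>R f + t *\<^sub>R g | s t. t = k * s\<^sup>2})"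
    unfolding planar_locus_def using h(2) by blast
  moreover have "- k > 0" using False \<open>k \<noteq> 0\<close> by simp
  ultimately show ?thesis unfolding is_parabola_def by blast
qed

context complement_frame
begin

lemma circles_if_definite:
  assumes \<epsilon>: "\<epsilon> = 1"
    and h: "linear h" "norm (h f) = 1" "norm (h g) = 1" "h f \<bullet> h g = 0"
    and F: "nonsingular_fiber L F"
  shows "is_circle (h ` F)"
proof -
  have "\<epsilon> * \<epsilon> = 1" using \<epsilon> by simp
  then obtain c R where "R \<noteq> 0" and F_eq: "F = {c + s *\<^sub>R f + t *\<^sub>R g | s t. s\<^sup>2 + \<epsilon> * t\<^sup>2 = R}"
    using F by (rule nonsingular_central_conic)
  obtain s t where "s\<^sup>2 + t\<^sup>2 = R"
    using F \<epsilon> unfolding nonsingular_fiber_def F_eq by auto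
  then have "R \<ge> 0" by (metis sum_power2_ge_zero)
  then have "R = (sqrt R)\<^sup>2" "sqrt R > 0" using \<open>R \<noteq> 0\<close> by simp_all
  moreover have "planar_locus (\<lambda>s t. s\<^sup>2 + t\<^sup>2 = R) (h ` F)"
    using image_planar_locus[OF h, of "\<lambda>s t. s\<^sup>2 + \<epsilon> * t\<^sup>2 = R"] unfolding F_eq \<epsilon> by simp
  ultimately show ?thesis unfolding is_circle_def by metis
qed

lemma hyperbolas_if_indefinite:
  assumes \<epsilon>: "\<epsilon> = - 1"
    and h: "linear h" "norm (h f) = 1" "norm (h g) = 1" "h f \<bullet> h g = 0"
    and F: "nonsingular_fiber L F"
  shows "is_equilateral_hyperbola (h ` F)"
proof -
  have "\<epsilon> * \<epsilon> = 1" using \<epsilon> by simp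
  then obtain c R where "R \<noteq> 0" and F_eq: "F = {c + s *\<^sub>R f + t *\<^sub>R g | s t. s\<^sup>2 + \<epsilon> * t\<^sup>2 = R}"
    using F by (rule nonsingular_central_conic)
  have pl: "planar_locus (\<lambda>s t. s\<^sup>2 - t\<^sup>2 = R) (h ` F)"
    using image_planar_locus[OF h, of "\<lambda>s t. s\<^sup>2 + \<epsilon> * t\<^sup>2 = R"] unfolding F_eq \<epsilon> by simp
  show ?thesis
  proof (cases "R > 0")
    case True
    then have "R = (sqrt R)\<^sup>2" "sqrt R > 0" by simp_all
    with pl show ?thesis unfolding is_equilateral_hyperbola_def by metis
  next
    case False
    \<comment> \<open>the two axes change roles\<close>
    then have R: "R = - (sqrt (- R))\<^sup>2" "sqrt (- R) > 0" using \<open>R \<noteq> 0\<close> by simp_all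
    have "(t\<^sup>2 - s\<^sup>2 = R) = (s\<^sup>2 - t\<^sup>2 = (sqrt (- R))\<^sup>2)" for s t :: real
      using R(1) by linarith
    then have "planar_locus (\<lambda>s t. s\<^sup>2 - t\<^sup>2 = (sqrt (- R))\<^sup>2) (h ` F)"
      using pl planar_locus_swap[of "\<lambda>s t. s\<^sup>2 - t\<^sup>2 = R" "h ` F"] by simp
    with R(2) show ?thesis unfolding is_equilateral_hyperbola_def by blast
  qed
qed

lemma parabolas_if_degenerate:
  assumes \<epsilon>: "\<epsilon> = 0"
    and h: "linear h" "norm (h f) = 1" "norm (h g) = 1" "h f \<bullet> h g = 0"
    and F: "nonsingular_fiber L F"
  shows "is_parabola_or_at_infinity (h ` F)"
proof -
  obtain x where x: "F = L -` {L x}" and ns: "\<not> singular_point L x"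
    using F unfolding nonsingular_fiber_def by blast
  show ?thesis
  proof (cases "lorentz_inner (x - p i0) g = 0")
    case False
    with \<epsilon> obtain c k where "k \<noteq> 0" "L -` {L x} = {c + s *\<^sub>R f + t *\<^sub>R g | s t. t = k * s\<^sup>2}"
      by (rule degenerate_fiber_parabola)
    then show ?thesis
      using is_parabola_image[OF h] unfolding x is_parabola_or_at_infinity_def by simp
  next
    case True
    define b where "b = lorentz_inner (x - p i0) f"
    obtain c where c: "L -` {L x} = {c + s *\<^sub>R f + t *\<^sub>R g | s t. s = b \<or> s = - b}"
      by (rule degenerate_fiber_line_pair[OF \<epsilon> True, folded b_def])
    have "planar_locus (\<lambda>s t. s = b \<or> s = - b) (h ` F)"
      using image_planar_locus[OF h, of "\<lambda>s t. s = b \<or> s = - b"] unfolding x c by simp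
    then have "planar_locus (\<lambda>s t. t = b \<or> t = - b) (h ` F)"
      by (subst planar_locus_swap)
    moreover have "b \<noteq> - b" using ns True unfolding singular_point_iff b_def by simp
    ultimately show ?thesis
      unfolding is_parabola_or_at_infinity_def is_parallel_line_pair_def by blast
  qed
qed

text \<open>
  The Euclidean mirror image of \<open>g\<close> is not Lorentz orthogonal to \<open>g\<close>, so the fiber through the
  point displaced by it from \<open>p i0\<close> is a parabola rather than a pair of lines.
\<close>

lemma connected_nonsingular_fiber_if_degenerate:
  assumes \<epsilon>: "\<epsilon> = 0"
  obtains F where "nonsingular_fiber L F" "connected F"
proof -
  have "g \<noteq> 0" using indep[of 0 1] by auto
  define x where "x = p i0 + (- fst g, snd g)"
  have b2: "lorentz_inner (x - p i0) g \<noteq> 0"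
  proof -
    have "lorentz_inner (x - p i0) g = g \<bullet> g"
      by (simp add: x_def lorentz_inner_eq inner_prod_def del: lorentz_inner_simps)
    then show ?thesis using \<open>g \<noteq> 0\<close> by simp
  qed
  have "\<not> singular_point L z" if "z \<in> L -` {L x}" for z
  proof -
    obtain a b where "z = x + a *\<^sub>R f + b *\<^sub>R g" using \<open>z \<in> L -` {L x}\<close> unfolding fiber_eq by blast
    then have "lorentz_inner (z - p i0) g = lorentz_inner (x - p i0) g"
      using \<epsilon> by simp
    then show ?thesis using b2 by (simp add: singular_point_iff del: lorentz_inner_simps)
  qed
  then have ns: "nonsingular_fiber L (L -` {L x})"
    unfolding nonsingular_fiber_def by blast
  moreover have "connected (L -` {L x})"
  proof -
    obtain c k where "L -` {L x} = {c + s *\<^sub>R f + t *\<^sub>R g | s t. t = k * s\<^sup>2}"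
      by (rule degenerate_fiber_parabola[OF \<epsilon> b2])
    then have "L -` {L x} = range (\<lambda>s. c + s *\<^sub>R f + (k * s\<^sup>2) *\<^sub>R g)" by auto
    then show ?thesis by (auto intro!: connected_continuous_image continuous_intros)
  qed
  ultimately show ?thesis using that by blast
qed

text \<open>
  A nonsingular fiber is now disconnected, so \<open>h\<close> would have to turn it into a pair of parallel
  lines, and each of its branches into part of a line.  The nonsingular fibers in the translate of the
  complement through \<open>p i0\<close> are hyperbolas with the null lines along \<open>f + g\<close> and \<open>f - g\<close> as asymptotes, and they come
  arbitrarily close to \<open>p i0\<close>, where \<open>h\<close> is differentiable: this contradicts the blow-up argument.
\<close>

lemma no_parabolas_if_indefinite:
  assumes \<epsilon>: "\<epsilon> = - 1" and h: "diffeomorphism h"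
    and par: "\<And>F. nonsingular_fiber L F \<Longrightarrow> is_parabola_or_at_infinity (h ` F)"
  shows False
proof -
  obtain h' :: "'n minkowski \<Rightarrow> 'n minkowski" where h': "linear h'" "diffeomorphism h'"
    "norm (h' f) = 1" "norm (h' g) = 1" "h' f \<bullet> h' g = 0"
    by (rule orthonormalizing_diffeomorphism[OF indep])
  have indep': "a = 0 \<and> b = 0" if "a *\<^sub>R (f + g) + b *\<^sub>R (f - g) = 0" for a b
  proof -
    have "(a + b) *\<^sub>R f + (a - b) *\<^sub>R g = 0" using that by (simp add: algebra_simps)
    then show ?thesis using indep by fastforce
  qed
  have col: "collinear (h ` {p i0 + s *\<^sub>R (f + g) + t *\<^sub>R (f - g) | s t. s > 0 \<and> t > 0 \<and> s * t = \<sigma>\<^sup>2})"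
    (is "collinear (h ` ?S)") if "\<sigma> > 0" for \<sigma>
  proof -
    let ?F = "{p i0 + s *\<^sub>R f + t *\<^sub>R g | s t. s\<^sup>2 + \<epsilon> * t\<^sup>2 = (2 * \<sigma>)\<^sup>2}"
    have F: "nonsingular_fiber L ?F"
      by (rule central_conic_nonsingular[of _ "2 * \<sigma>" 0]) (use \<epsilon> that in auto)
    \<comment> \<open>a linear diffeomorphism already shows the topological type of the fiber\<close>
    have "\<not> connected ?F"
      using hyperbolas_if_indefinite[OF \<epsilon> h'(1,3-5) F] not_connected_equilateral_hyperbola
        connected_diffeomorphism_image[OF h'(2)] by blast
    then have "\<not> is_parabola (h ` ?F)"
      using connected_parabola connected_diffeomorphism_image[OF h] by blast
    then have pair: "is_parallel_line_pair (h ` ?F)"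
      using par[OF F] unfolding is_parabola_or_at_infinity_def by blast
    have S_F: "?S \<subseteq> ?F"
    proof
      fix z assume "z \<in> ?S"
      then obtain s t where z: "z = p i0 + s *\<^sub>R (f + g) + t *\<^sub>R (f - g)" and st: "s * t = \<sigma>\<^sup>2" by blast
      have "z = p i0 + (s + t) *\<^sub>R f + (s - t) *\<^sub>R g" unfolding z by (simp add: algebra_simps)
      moreover have "(s + t)\<^sup>2 + \<epsilon> * (s - t)\<^sup>2 = 4 * (s * t)"
        unfolding \<epsilon> by (simp add: power2_eq_square algebra_simps)
      then have "(s + t)\<^sup>2 + \<epsilon> * (s - t)\<^sup>2 = (2 * \<sigma>)\<^sup>2" unfolding st by (simp add: power_mult_distrib)
      ultimately show "z \<in> ?F" by blast
    qed
    have "?S = (\<lambda>s. p i0 + s *\<^sub>R (f + g) + (\<sigma>\<^sup>2 / s) *\<^sub>R (f - g)) ` {0<..}"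
    proof (intro set_eqI iffI)
      fix z assume "z \<in> ?S"
      then obtain s t where z: "z = p i0 + s *\<^sub>R (f + g) + t *\<^sub>R (f - g)" "s > 0" "s * t = \<sigma>\<^sup>2" by blast
      then have "t = \<sigma>\<^sup>2 / s" by (simp add: field_simps)
      with z show "z \<in> (\<lambda>s. p i0 + s *\<^sub>R (f + g) + (\<sigma>\<^sup>2 / s) *\<^sub>R (f - g)) ` {0<..}" by blast
    next
      fix z assume "z \<in> (\<lambda>s. p i0 + s *\<^sub>R (f + g) + (\<sigma>\<^sup>2 / s) *\<^sub>R (f - g)) ` {0<..}"
      then obtain s where "z = p i0 + s *\<^sub>R (f + g) + (\<sigma>\<^sup>2 / s) *\<^sub>R (f - g)" "s > 0" by blast
      moreover from this(2) have "\<sigma>\<^sup>2 / s > 0" "s * (\<sigma>\<^sup>2 / s) = \<sigma>\<^sup>2" using that by simp_all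
      ultimately show "z \<in> ?S" by blast
    qed
    then have "connected ?S"
      by (auto intro!: connected_continuous_image continuous_intros)
    then have "connected (h ` ?S)" using connected_diffeomorphism_image[OF h] by blast
    then show ?thesis
      by (rule collinear_connected_subset_of_parallel_line_pair[OF pair _ image_mono[OF S_F]])
  qed
  have "\<exists>\<sigma>>0. \<not> collinear (h ` {p i0 + s *\<^sub>R (f + g) + t *\<^sub>R (f - g)
      | s t. s > 0 \<and> t > 0 \<and> s * t = \<sigma>\<^sup>2})"
    by (rule not_collinear_hyperbola_branches[OF h indep'])
  then show False
  proof (elim exE conjE)
    fix \<sigma> :: real
    assume "\<sigma> > 0" and "\<not> collinear (h ` {p i0 + s *\<^sub>R (f + g) + t *\<^sub>R (f - g)
      | s t. s > 0 \<and> t > 0 \<and> s * t = \<sigma>\<^sup>2})"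
    from this(2) col[OF this(1)] show False by (rule notE)
  qed
qed

end

section \<open>The classification\<close>

theorem corollary1:
  fixes p :: "'n::finite \<Rightarrow> 'n minkowski" and i0 :: 'n
  assumes "CARD('n) \<ge> 2"
    and "general_position i0 p"
  shows "((\<exists>h :: 'n minkowski \<Rightarrow> 'n minkowski. diffeomorphism h \<and>
            (\<forall>F. nonsingular_fiber (lorentz_dist_sq_map p) F \<longrightarrow> is_circle (h ` F)))
          \<longleftrightarrow> timelike_subspace (recognition_subspace i0 p)) \<and>
         ((\<exists>h :: 'n minkowski \<Rightarrow> 'n minkowski. diffeomorphism h \<and>
            (\<forall>F. nonsingular_fiber (lorentz_dist_sq_map p) F \<longrightarrow> is_equilateral_hyperbola (h ` F)))
          \<longleftrightarrow> spacelike_subspace (recognition_subspace i0 p)) \<and>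
         ((\<exists>h :: 'n minkowski \<Rightarrow> 'n minkowski. diffeomorphism h \<and>
            (\<forall>F. nonsingular_fiber (lorentz_dist_sq_map p) F \<longrightarrow> is_parabola_or_at_infinity (h ` F)))
          \<longleftrightarrow> lightlike_subspace (recognition_subspace i0 p))"
proof -
  obtain f g \<epsilon> where "complement_frame p i0 f g \<epsilon>" and \<epsilon>: "\<epsilon> \<in> {1, - 1, 0}"
    using complement_frame_exists[OF assms(2)] .
  then interpret complement_frame p i0 f g \<epsilon> by simp
  let ?V = "recognition_subspace i0 p"
  have sub: "subspace ?V" unfolding recognition_subspace_def by (rule subspace_span)
  have types: "timelike_subspace ?V \<longleftrightarrow> \<epsilon> = 1" "spacelike_subspace ?V \<longleftrightarrow> \<epsilon> = - 1"
    "lightlike_subspace ?V \<longleftrightarrow> \<epsilon> = 0"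
    using sign_if_timelike[OF _ \<epsilon>] sign_if_spacelike[OF _ \<epsilon>] sign_if_lightlike[OF _ \<epsilon>] sub
    unfolding lightlike_subspace_def by fastforce+
  obtain h0 :: "'n minkowski \<Rightarrow> 'n minkowski" where h0: "linear h0" "norm (h0 f) = 1" "norm (h0 g) = 1"
      "h0 f \<bullet> h0 g = 0" and d0: "diffeomorphism h0"
    by (rule orthonormalizing_diffeomorphism[OF indep])
  note circles = circles_if_definite[OF _ h0] and hyperbolas = hyperbolas_if_indefinite[OF _ h0]
    and parabolas = parabolas_if_degenerate[OF _ h0]
  \<comment> \<open>one fiber to compare with; for \<open>\<epsilon> = 0\<close> it has to be connected to exclude hyperbolas\<close>
  obtain F where F: "nonsingular_fiber L F" and F_connected: "\<epsilon> = 0 \<Longrightarrow> connected F"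
  proof (cases "\<epsilon> = 0")
    case True
    then show ?thesis using connected_nonsingular_fiber_if_degenerate that by blast
  next
    case False
    then have "\<epsilon> * \<epsilon> = 1" using \<epsilon> by auto
    then show ?thesis
      using central_conic_nonsingular[of 1 1 0] False that by simp
  qed
  have compact_iff: "compact F \<longleftrightarrow> \<epsilon> = 1"
  proof
    assume "compact F"
    then have "compact (h0 ` F)" using compact_diffeomorphism_image[OF d0] by blast
    then have "\<epsilon> \<noteq> - 1" "\<epsilon> \<noteq> 0"
      using hyperbolas[OF _ F] parabolas[OF _ F] not_compact_equilateral_hyperbola
        not_compact_parabola not_compact_parallel_line_pair
      unfolding is_parabola_or_at_infinity_def by blast+
    then show "\<epsilon> = 1" using \<epsilon> by blast
  next
    assume "\<epsilon> = 1"
    then show "compact F"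
      using circles[OF _ F] compact_circle compact_diffeomorphism_image[OF d0] by blast
  qed
  have circle: "\<epsilon> = 1" if "diffeomorphism h" "\<forall>F. nonsingular_fiber L F \<longrightarrow> is_circle (h ` F)"
    for h :: "'n minkowski \<Rightarrow> 'n minkowski"
    using that F compact_circle compact_diffeomorphism_image[OF that(1)] compact_iff by blast
  have hyperbola: "\<epsilon> = - 1"
    if h: "diffeomorphism h" "\<forall>F. nonsingular_fiber L F \<longrightarrow> is_equilateral_hyperbola (h ` F)"
    for h :: "'n minkowski \<Rightarrow> 'n minkowski"
  proof -
    have "is_equilateral_hyperbola (h ` F)" using h(2) F by blast
    then have "\<not> compact F" "\<not> connected F"
      using not_compact_equilateral_hyperbola not_connected_equilateral_hyperbola
        compact_diffeomorphism_image[OF h(1)] connected_diffeomorphism_image[OF h(1)] by blast+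
    then show ?thesis using \<epsilon> compact_iff F_connected by blast
  qed
  have parabola: "\<epsilon> = 0"
    if h: "diffeomorphism h" "\<forall>F. nonsingular_fiber L F \<longrightarrow> is_parabola_or_at_infinity (h ` F)"
    for h :: "'n minkowski \<Rightarrow> 'n minkowski"
  proof -
    have "is_parabola_or_at_infinity (h ` F)" using h(2) F by blast
    then have "\<not> compact F"
      using not_compact_parabola not_compact_parallel_line_pair compact_diffeomorphism_image[OF h(1)]
      unfolding is_parabola_or_at_infinity_def by blast
    then show ?thesis using \<epsilon> compact_iff no_parabolas_if_indefinite[OF _ h(1)] h(2) by blast
  qed
  show ?thesis
    unfolding types
  proof (intro conjI iffI)
    assume "\<epsilon> = 1"
    then show "\<exists>h :: 'n minkowski \<Rightarrow> 'n minkowski. diffeomorphism h \<and>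
        (\<forall>F. nonsingular_fiber L F \<longrightarrow> is_circle (h ` F))"
      using d0 circles by (intro exI[of _ h0]) simp
  next
    assume "\<epsilon> = - 1"
    then show "\<exists>h :: 'n minkowski \<Rightarrow> 'n minkowski. diffeomorphism h \<and>
        (\<forall>F. nonsingular_fiber L F \<longrightarrow> is_equilateral_hyperbola (h ` F))"
      using d0 hyperbolas by (intro exI[of _ h0]) simp
  next
    assume "\<epsilon> = 0"
    then show "\<exists>h :: 'n minkowski \<Rightarrow> 'n minkowski. diffeomorphism h \<and>
        (\<forall>F. nonsingular_fiber L F \<longrightarrow> is_parabola_or_at_infinity (h ` F))"
      using d0 parabolas by (intro exI[of _ h0]) simp
  qed (elim exE conjE, erule (1) circle hyperbola parabola)+
qed

end
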